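(* Let $\mu^{\mathrm{bwd}}_{k,N}$ and $\mu^{\mathrm{fwd}}_{k,N}$ be the normalized height distributions of the backward and forward depth-$N$ descendant shadows whose root has height $k$, where $N\ge 0$ is an integer and $k\ge0$ in the backward case, $k\ge1$ in the forward case. Assume admissible parity, i.e. $k+N\equiv 0\pmod 2$. For $\Phi\in L^1(\rho^{\mathrm{ev}})$ put $\langle\Phi\rangle_{\rho^{\mathrm{ev}}}=\sum_{m\ge0}\Phi(2m)\rho^{\mathrm{ev}}(2m)$. (a) For a backward initial state with $M=N-k\ge0$ and every $\Phi\in L^1(\rho^{\mathrm{ev}})$, $$\int \Phi\,d\mu^{\mathrm{bwd}}_{k,N}-\langle\Phi\rangle_{\rho^{\mathrm{ev}}} = q^{-M-1}\Phi(M)-\sum_{2m\ge M+2}\rho^{\mathrm{ev}}(2m)\Phi(2m).$$ (b) For a forward initial state and every $\Phi\in L^1(\rho^{\mathrm{ev}})$, $$\int \Phi\,d\mu^{\mathrm{fwd}}_{k,N}-\langle\Phi\rangle_{\rho^{\mathrm{ev}}} =q^{-N}\bigl(\Phi(k+N)-\langle\Phi\rangle_{\rho^{\mathrm{ev}}}\bigr) +(q-1)\sum_{r=0}^{N-1}q^{-r-1}\left(\int \Phi\,d\mu^{\mathrm{bwd}}_{k+r-1,N-r-1}-\langle\Phi\rangle_{\rho^{\mathrm{ev}}}\right).$$ (c) Consequently, if $\Phi\in L^1(\rho^{\mathrm{ev}})$, then for each fixed initial height $k$ ($k\ge 0$ backward, $k\ge1$ forward), $\int\Phi\,d\mu^{\mathrm{bwd}}_{k,N}\to\langle\Phi\rangle_{\rho^{\mathrm{ev}}}$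 and $\int\Phi\,d\mu^{\mathrm{fwd}}_{k,N}\to\langle\Phi\rangle_{\rho^{\mathrm{ev}}}$ as $N\to\infty$ through integers with $k+N$ even. (d) If $|\Phi(2m)|\le Cq^{\alpha m}$ for all $m\ge0$, with $C>0$ and $\alpha<2$, then the convergence is exponential with the following explicit exponents, for $N\ge k$ with $k+N$ even: in the backward case ($k\ge0$), $$\left|\int \Phi\,d\mu^{\mathrm{bwd}}_{k,N}-\langle\Phi\rangle_{\rho^{\mathrm{ev}}}\right|\ll_{q,\alpha} C q^{-(2-\alpha)(N-k)/2},$$ and in the forward case ($k\ge1$ fixed), with $\beta=(2-\alpha)/2$, $$\left|\int \Phi\,d\mu^{\mathrm{fwd}}_{k,N}-\langle\Phi\rangle_{\rho^{\mathrm{ev}}}\right|\ll_{q,\alpha,k}\begin{cases} Cq^{-N/2}, & \alpha<1,\\ CNq^{-N/2}, & \alpha=1,\\ Cq^{-\beta N}, & 1<\alpha<2.\end{cases}$$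
   Context: Let $q$ be a prime power, $F=\mathbb F_q((t^{-1}))$, $\mathcal O=\mathbb F_q[[t^{-1}]]$, $\pi=t^{-1}$. $\mathcal T$ is the Bruhat--Tits tree of $\mathrm{PGL}_2(F)$: vertices are homothety classes $[L]$ of $\mathcal O$-lattices in $F^2$, two classes being adjacent if representatives can be chosen with $\pi L\subsetneq L'\subsetneq L$ and $L/L'\simeq\mathbb F_q$; it is $(q+1)$-regular. Put $v_n=[\mathrm{diag}(t^n,1)]\cdot[\mathcal O^2]$ for $n\ge 0$. The quotient of $\mathcal T$ by $\mathrm{PGL}_2(\mathbb F_q[t])$ is a ray represented by $v_0-v_1-v_2-\cdots$ (the Nagao ray), and the height $h(v)\in\mathbb Z_{\ge0}$ of a vertex $v$ is the $n$ for which $v$ lies in the $\mathrm{PGL}_2(\mathbb F_q[t])$-orbit of $v_n$. All neighbors of a height-$0$ vertex have height $1$; a vertex of height $k\ge1$ has exactly one neighbor of height $k+1$ and exactly $q$ neighbors of height $k-1$. Oriented states: an oriented edge $e=(z_{-1},z_0)$ of $\mathcal T$ with $h(z_0)=k$ is forward (state $(\mathrm{fwd},k)$, $k\ge 1$) if $h(z_{-1})=k-1$, and backward (state $(\mathrm{bwd},k)$, $k\ge0$) if $h(z_{-1})=k+1$. For $N\ge0$ the depth-$N$ descendant shadow $\mathrm{Desc}_N(e)$ is the set of terminal vertices $z_N$ of non-backtracking paths $z_{-1}\to z_0\to z_1\to\cdots\to z_N$; it has exactly $q^N$ elements. $\mu^{\mathrm{fwd}}_{k,N}(j)$ (resp.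 $\mu^{\mathrm{bwd}}_{k,N}(j)$) is $q^{-N}$ times the number of vertices of height $j$ in $\mathrm{Desc}_N(e)$ for $e$ in state $(\mathrm{fwd},k)$ (resp. $(\mathrm{bwd},k)$); this depends only on the state. When $k+N$ is even these are probability measures on $2\mathbb Z_{\ge0}$. The law $\rho^{\mathrm{ev}}$ on $2\mathbb Z_{\ge0}$ is $\rho^{\mathrm{ev}}(0)=\frac{q-1}{q}$, $\rho^{\mathrm{ev}}(2m)=(q^2-1)q^{-2m-1}$ for $m\ge1$. Profiles are functions $\Phi:2\mathbb Z_{\ge0}\to\mathbb C$. $A\ll_{p}B$ means $|A|\le C'B$ with $C'$ depending only on the indicated parameters $p$. *)

theory Defs
  imports "HOL-Analysis.Analysis" "HOL-Computational_Algebra.Formal_Laurent_Series"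
begin

text \<open>
  The finite field \<open>F_q\<close> is the type \<open>'a :: {field, finite}\<close> with \<open>q = CARD('a)\<close>.
  The local field \<open>F = F_q((t\<^sup>-\<^sup>1))\<close> is the type \<open>'a fls\<close>, the series variable
  \<open>fls_X\<close> being the uniformizer \<open>\<pi> = t\<^sup>-\<^sup>1\<close>, so that \<open>t\<close> is \<open>fls_X_inv\<close>.
\<close>

definition int_ring :: "'a::field fls set" where
  "int_ring = range fps_to_fls"

definition poly_ring :: "'a::field fls set" where
  "poly_ring = range (\<lambda>p :: 'a poly. poly (map_poly fls_const p) fls_X_inv)"


subsection \<open>The Bruhat--Tits tree\<close>

definition std_lattice :: "('a::field fls ^ 2) set" where
  "std_lattice = {v. \<forall>i. v $ i \<in> int_ring}"

text \<open>A lattice is the \<open>\<O>\<close>-span of an \<open>F\<close>-basis (the columns of \<open>g\<close>) of \<open>F\<^sup>2\<close>.\<close>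

definition is_lattice :: "('a::field fls ^ 2) set \<Rightarrow> bool" where
  "is_lattice L \<longleftrightarrow> (\<exists>g :: 'a fls ^ 2 ^ 2. invertible g \<and> L = (*v) g ` std_lattice)"

type_synonym 'a vertex = "('a fls ^ 2) set set"

definition homothety_class :: "('a::field fls ^ 2) set \<Rightarrow> 'a vertex" where
  "homothety_class L = {(*s) c ` L | c. c \<noteq> 0}"

definition vertices :: "'a::field vertex set" where
  "vertices = {homothety_class L | L. is_lattice L}"

text \<open>
  \<open>L/L' \<simeq> F_q\<close> as \<open>\<O>\<close>-modules, expressed as the existence of a surjective \<open>\<O>\<close>-linear map
  \<open>L \<rightarrow> F_q\<close> with kernel \<open>L'\<close>; here \<open>c \<in> \<O>\<close> acts on the residue field through its constant
  coefficient.
\<close>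

definition quotient_is_residue_field ::
  "('a::field fls ^ 2) set \<Rightarrow> ('a fls ^ 2) set \<Rightarrow> bool" where
  "quotient_is_residue_field L L' \<longleftrightarrow> (\<exists>f :: 'a fls ^ 2 \<Rightarrow> 'a.
     (\<forall>v\<in>L. \<forall>w\<in>L. f (v + w) = f v + f w) \<and>
     (\<forall>c\<in>int_ring. \<forall>v\<in>L. f (c *s v) = fls_nth c 0 * f v) \<and>
     f ` L = UNIV \<and> {v\<in>L. f v = 0} = L')"

definition adjacent :: "'a::field vertex \<Rightarrow> 'a vertex \<Rightarrow> bool" where
  "adjacent x y \<longleftrightarrow> x \<in> vertices \<and> y \<in> vertices \<and>
     (\<exists>L\<in>x. \<exists>L'\<in>y. (*s) fls_X ` L \<subset> L' \<and> L' \<subset> L \<and> quotient_is_residue_field L L')"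


subsection \<open>Heights\<close>

definition GL2_poly :: "('a::field fls ^ 2 ^ 2) set" where
  "GL2_poly = {g. (\<forall>i j. g $ i $ j \<in> poly_ring) \<and>
     (\<exists>h. (\<forall>i j. h $ i $ j \<in> poly_ring) \<and> g ** h = mat 1 \<and> h ** g = mat 1)}"

definition act :: "'a::field fls ^ 2 ^ 2 \<Rightarrow> 'a vertex \<Rightarrow> 'a vertex" where
  "act g x = (\<lambda>L. (*v) g ` L) ` x"

definition ray_vertex :: "nat \<Rightarrow> 'a::field vertex" where
  "ray_vertex n =
     act (vector [vector [fls_X_inv ^ n, 0], vector [0, 1]]) (homothety_class std_lattice)"

text \<open>
  Scalar matrices act trivially on homothety classes, so orbits under
  \<open>PGL\<^sub>2(F_q[t]) = GL\<^sub>2(F_q[t]) / F_q\<^sup>*\<close> are orbits under \<open>GL\<^sub>2(F_q[t])\<close>.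
\<close>

definition height :: "'a::field vertex \<Rightarrow> nat" where
  "height v = (THE n. \<exists>g\<in>GL2_poly. v = act g (ray_vertex n))"


subsection \<open>Descendant shadows and their height distributions\<close>

text \<open>An oriented edge is the pair \<open>(z\<^sub>-\<^sub>1, z\<^sub>0)\<close>.\<close>

definition bwd_edges :: "nat \<Rightarrow> ('a::field vertex \<times> 'a vertex) set" where
  "bwd_edges k = {(x, y). adjacent x y \<and> height y = k \<and> height x = k + 1}"

definition fwd_edges :: "nat \<Rightarrow> ('a::field vertex \<times> 'a vertex) set" where
  "fwd_edges k = {(x, y). adjacent x y \<and> height y = k \<and> height x + 1 = k}"

text \<open>The index is shifted by one: \<open>z i\<close> stands for \<open>z\<^sub>i\<^sub>-\<^sub>1\<close>.\<close>

definition Desc :: "nat \<Rightarrow> 'a::field vertex \<times> 'a vertex \<Rightarrow> 'a vertex set" where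
  "Desc N e = {z (N + 1) | z. z 0 = fst e \<and> z 1 = snd e \<and>
     (\<forall>i\<le>N. adjacent (z i) (z (i + 1))) \<and> (\<forall>i<N. z (i + 2) \<noteq> z i)}"

definition shadow_law ::
  "'a::{field,finite} vertex \<times> 'a vertex \<Rightarrow> nat \<Rightarrow> nat \<Rightarrow> real" where
  "shadow_law e N j = real (card {v \<in> Desc N e. height v = j}) / real CARD('a) ^ N"

text \<open>
  The law depends only on the state of the edge; \<open>the_elem\<close> selects the common value over
  all edges in that state (and is unspecified unless there is exactly one such value).
\<close>

definition mu_bwd :: "'a::{field,finite} itself \<Rightarrow> nat \<Rightarrow> nat \<Rightarrow> nat \<Rightarrow> real" where
  "mu_bwd _ k N j =
     the_elem ((\<lambda>e :: 'a vertex \<times> 'a vertex. shadow_law e N j) ` bwd_edges k)"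

definition mu_fwd :: "'a::{field,finite} itself \<Rightarrow> nat \<Rightarrow> nat \<Rightarrow> nat \<Rightarrow> real" where
  "mu_fwd _ k N j =
     the_elem ((\<lambda>e :: 'a vertex \<times> 'a vertex. shadow_law e N j) ` fwd_edges k)"

definition rho_ev :: "nat \<Rightarrow> nat \<Rightarrow> real" where
  "rho_ev q j =
     (if j = 0 then (real q - 1) / real q
      else ((real q)\<^sup>2 - 1) * real q powi (- int j - 1))"

text \<open>
  The measure on \<open>2\<int>\<^bsub>\<ge>0\<^esub>\<close> with point masses \<open>p j\<close>. A profile is represented by a function
  \<open>nat \<Rightarrow> complex\<close>, whose values at odd arguments are irrelevant for these measures.
\<close>

definition ev_measure :: "(nat \<Rightarrow> real) \<Rightarrow> nat measure" where
  "ev_measure p = point_measure {j. even j} (\<lambda>j. ennreal (p j))"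

definition mean_ev :: "nat \<Rightarrow> (nat \<Rightarrow> complex) \<Rightarrow> complex" where
  "mean_ev q \<Phi> = (\<Sum>\<^sub>\<infinity>m. \<Phi> (2 * m) * of_real (rho_ev q (2 * m)))"

end

theory Submission
  imports Defs
begin

text \<open>
  The proof turns the tree into a Markov chain on heights and solves the recursion of its means.

  Every vertex is the class of \<open>g \<O>\<^sup>2\<close> for some invertible matrix \<open>g\<close>, and since adjacency is
  invariant under the group, the neighbours of all vertices are known once those of \<open>[\<O>\<^sup>2]\<close>
  are: they are the kernels of the nonzero linear forms on \<open>F\<^sub>q\<^sup>2\<close>, hence are \<open>q + 1\<close> in number
  (\<open>adjacent_iff_step\<close>, \<open>card_neighbours\<close>).  At a translate of \<open>v\<^sub>n\<close> under the modular group
  these neighbours are again translates of ray vertices, for \<open>n \<ge> 1\<close> with one neighbour higher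
  and \<open>q\<close> lower (\<open>neighbour_height_Suc\<close>); comparing degrees of polynomials shows that the \<open>v\<^sub>n\<close> are
  inequivalent (\<open>ray_orbit_le\<close>), so that heights are well defined.

  To count the vertices of a shadow one has to know that different non-backtracking paths from the
  same start end at different vertices.  For this the graph is hung from a fixed end: each vertex has
  a parent, one end of every edge is the parent of the other (\<open>adjacent_parent_cases\<close>), and no
  iterate of the parent map has a fixed point (\<open>parent_aperiodic\<close>).  A non-backtracking path climbs
  for a while and from then on only descends, and both parts can be read off from its ends
  (\<open>nb_path_first_step_unique\<close>).  A shadow is therefore the disjoint union of the shadows of the
  next edges, which gives a recursion for the means of a profile \<open>\<Phi>\<close> over the shadows
  (\<open>Desc_sum\<close>): writing \<open>B k N\<close> and \<open>F k N\<close> for the backward and forward means,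
  \<open>B (k+1) (N+1) = B k N\<close>, \<open>B 0 (N+1) = F 1 N\<close> and
  \<open>q F k (N+1) = F (k+1) N + (q-1) B (k-1) N\<close>.

  The recursion is solved by the identity
  \<open>F (k+1) (N+1) = F k N + (\<Phi>(k+N+2) - \<Phi>(k+N)) / q\<^sup>N\<^sup>+\<^sup>1\<close> (\<open>fwd_mean_diagonal\<close>).  It gives
  \<open>B 0 (2m+2) - B 0 (2m) = (\<Phi>(2m+2) - \<Phi>(2m)) / q\<^sup>2\<^sup>m\<^sup>+\<^sup>1\<close>, and summation by parts shows that
  \<open>B 0 (2m)\<close> is the partial sum of \<open>\<langle>\<Phi>\<rangle>\<close> up to \<open>\<Phi>(2m)\<close> plus the boundary term
  \<open>q\<^sup>-\<^sup>2\<^sup>m\<^sup>-\<^sup>1 \<Phi>(2m)\<close> (\<open>bwd_chain_closed_form\<close>), which is (a).  Unrolling the forward recursion is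
  (b).  The same identity compares the forward means at a fixed height with the backward ones, up to
  finitely many terms \<open>\<Phi>(2j) / q\<^sup>2\<^sup>j\<close>; these tend to \<open>0\<close> if \<open>\<Phi>\<close> is integrable, which is (c),
  and they are \<open>O(q\<^sup>-\<^sup>(\<^sup>2\<^sup>-\<^sup>\<alpha>\<^sup>)\<^sup>j)\<close> under the growth condition of (d).  In this way the forward
  means converge at the rate \<open>q\<^sup>-\<^sup>\<beta>\<^sup>N\<close> for all \<open>\<alpha> < 2\<close>, which implies the bounds in (d).
\<close>

text \<open>The symbol \<open>$\<close> is reserved for the components of vectors and matrices.\<close>

no_notation fps_nth (infixl "$" 75)
notation fls_nth (infixl "$$" 75)

section \<open>Laurent series and two-by-two matrices\<close>

lemma int_ring_iff: "f \<in> int_ring \<longleftrightarrow> fls_subdegree f \<ge> 0"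
proof
  assume "fls_subdegree f \<ge> 0"
  then have "f = fps_to_fls (fls_regpart f)"
    by (simp add: fls_regpart_to_fls_trivial)
  then show "f \<in> int_ring" unfolding int_ring_def by blast
qed (auto simp: int_ring_def fls_subdegree_fls_to_fps_gt0)

lemma int_ring_simps [simp, intro]:
  "0 \<in> int_ring" "1 \<in> int_ring" "fls_X \<in> int_ring" "fls_const c \<in> int_ring"
  by (simp_all add: int_ring_iff)

lemma int_ring_add [simp, intro]: "f \<in> int_ring \<Longrightarrow> g \<in> int_ring \<Longrightarrow> f + g \<in> int_ring"
  unfolding int_ring_def by (auto simp flip: fps_to_fls_plus)

lemma int_ring_mult [simp, intro]: "f \<in> int_ring \<Longrightarrow> g \<in> int_ring \<Longrightarrow> f * g \<in> int_ring"
  unfolding int_ring_def by (auto simp flip: fls_times_fps_to_fls)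

lemma int_ring_uminus [simp]: "- f \<in> int_ring \<longleftrightarrow> f \<in> int_ring"
  by (simp add: int_ring_iff)

lemma residue_mult:
  "f \<in> int_ring \<Longrightarrow> g \<in> int_ring \<Longrightarrow> (f * g) $$ 0 = f $$ 0 * (g $$ 0 :: 'a::field)"
  unfolding int_ring_def by (auto simp flip: fls_times_fps_to_fls)

lemma X_X_inv [simp]:
  "fls_X * fls_X_inv = (1 :: 'a::field fls)" "fls_X_inv * fls_X = (1 :: 'a::field fls)"
  using fls_inverse_X[where ?'a='a] fls_X_nonzero[where ?'a='a]
  by (metis left_inverse right_inverse)+

lemma X_X_inv_assoc [simp]:
  "fls_X * (fls_X_inv * f) = (f :: 'a::field fls)" "fls_X_inv * (fls_X * f) = f"
  by (simp_all flip: mult.assoc)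

lemma int_ring_residue_0:
  assumes "f \<in> int_ring" "f $$ 0 = (0::'a::field)"
  shows "fls_X_inv * f \<in> int_ring"
proof (cases "f = 0")
  case False
  have "fls_subdegree f \<ge> 1"
  proof (rule fls_subdegree_geI[OF False])
    fix k :: int assume "k < 1"
    then show "f $$ k = 0" using assms by (cases "k = 0") (auto simp: int_ring_iff)
  qed
  then show ?thesis using False by (simp add: int_ring_iff)
qed auto

lemma residue_X_mult [simp]: "f \<in> int_ring \<Longrightarrow> (fls_X * f) $$ 0 = (0::'a::field)"
  by (simp add: residue_mult)

text \<open>A series whose product with a unit is integral is itself integral; this is how scalars
  are recognized below.\<close>

lemma int_ring_cancel_unit:
  assumes "c * f \<in> int_ring" "f \<in> int_ring" "f $$ 0 \<noteq> (0::'a::field)"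
  shows "c \<in> int_ring"
proof (cases "c = 0")
  case False
  have "f \<noteq> 0" using assms(3) by auto
  moreover have "fls_subdegree f = 0"
    using assms(2,3) fls_subdegree_leI[of f 0] by (simp add: int_ring_iff)
  ultimately show ?thesis using assms(1) False by (simp add: int_ring_iff)
qed auto

definition mat2 :: "'b \<Rightarrow> 'b \<Rightarrow> 'b \<Rightarrow> 'b \<Rightarrow> 'b::zero ^ 2 ^ 2" where
  "mat2 a b c d = vector [vector [a, b], vector [c, d]]"

lemma mat2_nth [simp]:
  "mat2 a b c d $ 1 $ 1 = a" "mat2 a b c d $ 1 $ 2 = b"
  "mat2 a b c d $ 2 $ 1 = c" "mat2 a b c d $ 2 $ 2 = d"
  by (simp_all add: mat2_def)

lemma mat2_integral:
  assumes "a \<in> int_ring" "b \<in> int_ring" "c \<in> int_ring" "d \<in> int_ring"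
  shows "mat2 a b c d $ i $ j \<in> int_ring"
  using assms exhaust_2[of i] exhaust_2[of j] by auto

lemma mat2_eta: "g = mat2 (g$1$1) (g$1$2) (g$2$1) (g$2$2)"
  by (simp add: vec_eq_iff forall_2)

lemma mat2_mult:
  "mat2 a b c d ** mat2 a' b' c' d' =
   mat2 (a*a' + b*c') (a*b' + b*d') (c*a' + d*c') (c*b' + d*(d'::'b::semiring_1))"
  by (simp add: vec_eq_iff forall_2 matrix_matrix_mult_def sum_2)

lemma mat2_vec [simp]:
  "(mat2 a b c d *v v) $ 1 = a * v $ 1 + b * (v $ 2 :: 'b::semiring_1)"
  "(mat2 a b c d *v v) $ 2 = c * v $ 1 + d * (v $ 2)"
  by (simp_all add: matrix_vector_mult_def sum_2)

lemma mat_1_mat2: "mat 1 = mat2 1 0 0 (1::'b::semiring_1)"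
  by (simp add: vec_eq_iff forall_2 mat_def)

lemma vec2_eq_iff: "v = w \<longleftrightarrow> v $ 1 = w $ 1 \<and> v $ 2 = (w::'b^2) $ 2"
  by (simp add: vec_eq_iff forall_2)

lemma scalar_as_matrix: "mat2 c 0 0 c *v v = c *s (v :: 'b::semiring_1 ^ 2)"
  by (simp add: vec2_eq_iff)

lemma invertible_mat2_upper:
  assumes "a \<noteq> 0" "d \<noteq> (0::'b::field)" shows "invertible (mat2 a b 0 d)"
  unfolding invertible_def using assms
  by (intro exI[of _ "mat2 (1/a) (- b / (a * d)) 0 (1/d)"])
    (simp add: mat2_mult mat_1_mat2 vec_eq_iff forall_2 field_simps)

lemma matrix_vector_scalar: "g *v (c *s v) = c *s (g *v (v :: 'b::field ^ 2))"
  by (simp add: vector_scalar_commute)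

lemma inverse_cancel:
  assumes "h ** g = mat 1" shows "h *v (g *v v) = (v :: 'b::field ^ 2)"
  using assms by (simp add: matrix_vector_mul_assoc)

section \<open>Lattices and their classes\<close>

lemma std_lattice_iff: "v \<in> std_lattice \<longleftrightarrow> v $ 1 \<in> int_ring \<and> v $ 2 \<in> int_ring"
  by (simp add: std_lattice_def forall_2)

lemma std_lattice_scale: "c \<in> int_ring \<Longrightarrow> v \<in> std_lattice \<Longrightarrow> c *s v \<in> std_lattice"
  by (auto simp: std_lattice_iff)

lemma scale_scale_image: "(*s) c ` (*s) d ` L = (*s) (c * d) ` (L :: ('b::field ^ 2) set)"
  by (simp add: image_image vector_smult_assoc)

lemma scale_cancel: "c \<noteq> 0 \<Longrightarrow> (*s) c ` (*s) (inverse c) ` L = (L :: ('b::field ^ 2) set)"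
  "c \<noteq> 0 \<Longrightarrow> (*s) (inverse c) ` (*s) c ` L = (L :: ('b::field ^ 2) set)"
  by (simp_all add: scale_scale_image)

lemma scale_matrix_image: "(*v) g ` (*s) c ` L = (*s) c ` (*v) g ` (L :: ('b::field ^ 2) set)"
  by (simp add: image_image matrix_vector_scalar)

lemma matrix_matrix_image: "(*v) g ` (*v) h ` L = (*v) (g ** h) ` (L :: ('b::field ^ 2) set)"
  by (simp add: image_image matrix_vector_mul_assoc)

lemma homothety_class_image: "homothety_class L = (\<lambda>c. (*s) c ` L) ` (- {0})"
  unfolding homothety_class_def by blast

lemma homothety_class_self: "L \<in> homothety_class L"
  unfolding homothety_class_def by (rule CollectI, rule exI[of _ 1]) simp

lemma homothety_class_eq_iff:
  "homothety_class L = homothety_class M \<longleftrightarrow> (\<exists>c. c \<noteq> 0 \<and> L = (*s) c ` M)"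
proof
  assume "homothety_class L = homothety_class M"
  then show "\<exists>c. c \<noteq> 0 \<and> L = (*s) c ` M"
    using homothety_class_self[of L] unfolding homothety_class_def by auto
next
  assume "\<exists>c. c \<noteq> 0 \<and> L = (*s) c ` M"
  then obtain c where c: "c \<noteq> 0" "L = (*s) c ` M" by blast
  have "\<exists>e. (*s) d ` L = (*s) e ` M \<and> e \<noteq> 0" if "d \<noteq> 0" for d
    using c that by (intro exI[of _ "d * c"]) (simp add: scale_scale_image)
  moreover have "\<exists>e. (*s) d ` M = (*s) e ` L \<and> e \<noteq> 0" if "d \<noteq> 0" for d
    using c that by (intro exI[of _ "d * inverse c"]) (simp add: scale_scale_image mult.assoc)
  ultimately show "homothety_class L = homothety_class M"
    unfolding homothety_class_def by blast
qed

lemma homothety_class_mem: "L \<in> homothety_class M \<Longrightarrow> homothety_class L = homothety_class M"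
  unfolding homothety_class_eq_iff by (auto simp: homothety_class_def)

text \<open>The vertices are parametrized by the invertible matrices, and the whole geometry is
  expressed through this parametrization.\<close>

definition vertex_of :: "'a::field fls ^ 2 ^ 2 \<Rightarrow> 'a vertex" where
  "vertex_of g = homothety_class ((*v) g ` std_lattice)"

lemma vertex_of_eq_iff:
  "vertex_of g = vertex_of h \<longleftrightarrow> (\<exists>c. c \<noteq> 0 \<and> (*v) g ` std_lattice = (*s) c ` (*v) h ` std_lattice)"
  unfolding vertex_of_def by (rule homothety_class_eq_iff)

lemma vertices_eq: "x \<in> vertices \<longleftrightarrow> (\<exists>g. invertible g \<and> x = vertex_of g)"
  unfolding vertices_def is_lattice_def vertex_of_def by blast

lemma act_homothety_class: "act g (homothety_class L) = homothety_class ((*v) g ` L)"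
  unfolding act_def homothety_class_image image_image matrix_vector_scalar ..

lemma act_vertex_of: "act g (vertex_of h) = vertex_of (g ** h)"
  unfolding vertex_of_def act_homothety_class matrix_matrix_image ..

lemma vertex_of_in_vertices: "invertible g \<Longrightarrow> vertex_of g \<in> vertices"
  by (auto simp: vertices_eq)

lemma vertex_of_left_cancel:
  assumes "invertible g"
  shows "vertex_of (g ** h) = vertex_of (g ** h') \<longleftrightarrow> vertex_of h = vertex_of h'"
proof -
  obtain g' where "g' ** g = mat 1" using assms unfolding invertible_def by blast
  then have "act g' (vertex_of (g ** h)) = vertex_of h" for h
    by (simp add: act_vertex_of matrix_mul_assoc)
  then show ?thesis by (metis act_vertex_of)
qed

lemma vertex_of_scale: "c \<noteq> 0 \<Longrightarrow> vertex_of (mat2 c 0 0 c ** g) = vertex_of g"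
  unfolding vertex_of_eq_iff
  by (intro exI[of _ c]) (simp add: scalar_as_matrix image_image flip: matrix_vector_mul_assoc)

lemma integral_matrix_image:
  assumes "\<And>i j. k $ i $ j \<in> int_ring"
  shows "(*v) k ` std_lattice \<subseteq> std_lattice"
  using assms by (auto simp: std_lattice_iff matrix_vector_mult_def sum_2)

text \<open>Matrices that are invertible over \<open>\<O>\<close> stabilize \<open>\<O>\<^sup>2\<close>.\<close>

lemma vertex_of_right_unit:
  assumes "\<And>i j. k $ i $ j \<in> int_ring" "\<And>i j. k' $ i $ j \<in> int_ring" "k ** k' = mat 1"
  shows "vertex_of (g ** k) = vertex_of g"
proof -
  have "v \<in> (*v) k ` std_lattice" if "v \<in> std_lattice" for v
  proof
    show "v = k *v (k' *v v)" using inverse_cancel[OF assms(3)] by simp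
    show "k' *v v \<in> std_lattice" using integral_matrix_image[OF assms(2)] that by blast
  qed
  then have "(*v) k ` std_lattice = std_lattice"
    using integral_matrix_image[OF assms(1)] by blast
  then show ?thesis by (simp add: vertex_of_def flip: matrix_matrix_image)
qed

section \<open>The neighbours of a vertex\<close>

text \<open>The two kinds of maps \<open>\<phi>\<close> needed are multiplication by an invertible matrix and by a nonzero
  scalar.\<close>

lemma residue_field_quotient_image:
  assumes Q: "quotient_is_residue_field L L'"
    and inv: "\<And>v. \<psi> (\<phi> v) = v"
    and add: "\<And>v w. \<phi> (v + w) = \<phi> v + \<phi> w" and scale: "\<And>c v. \<phi> (c *s v) = c *s \<phi> v"
  shows "quotient_is_residue_field (\<phi> ` L) (\<phi> ` L')"
proof -
  obtain f where f: "\<forall>v\<in>L. \<forall>w\<in>L. f (v + w) = f v + f w"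
    "\<forall>c\<in>int_ring. \<forall>v\<in>L. f (c *s v) = fls_nth c 0 * f v" "f ` L = UNIV" "{v\<in>L. f v = 0} = L'"
    using Q unfolding quotient_is_residue_field_def by blast
  have eq: "f (\<psi> (\<phi> v + \<phi> w)) = f (v + w)" "f (\<psi> (c *s \<phi> v)) = f (c *s v)" for v w c
    by (simp_all add: inv flip: add scale)
  have "(f \<circ> \<psi>) ` \<phi> ` L = UNIV" using f(3) by (simp add: image_image inv)
  moreover have "{v \<in> \<phi> ` L. (f \<circ> \<psi>) v = 0} = \<phi> ` L'"
    unfolding f(4)[symmetric] by (auto simp: inv)
  ultimately show ?thesis
    unfolding quotient_is_residue_field_def
    using f(1,2) by (intro exI[of _ "f \<circ> \<psi>"]) (simp add: eq inv)
qed

definition elementary_pair :: "('a::field fls ^ 2) set \<Rightarrow> ('a fls ^ 2) set \<Rightarrow> bool" where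
  "elementary_pair L L' \<longleftrightarrow>
     (*s) fls_X ` L \<subset> L' \<and> L' \<subset> L \<and> quotient_is_residue_field L L'"

lemma adjacent_elementary_pair:
  "adjacent x y \<longleftrightarrow> x \<in> vertices \<and> y \<in> vertices \<and> (\<exists>L\<in>x. \<exists>L'\<in>y. elementary_pair L L')"
  unfolding adjacent_def elementary_pair_def by blast

lemma elementary_pair_image:
  assumes "elementary_pair L L'" and inv: "\<And>v. \<psi> (\<phi> v) = v"
    and add: "\<And>v w. \<phi> (v + w) = \<phi> v + \<phi> w" and scale: "\<And>c v. \<phi> (c *s v) = c *s \<phi> v"
  shows "elementary_pair (\<phi> ` L) (\<phi> ` L')"
proof -
  have "inj \<phi>" by (metis inv injI)
  then have sub: "\<phi> ` A \<subset> \<phi> ` B \<longleftrightarrow> A \<subset> B" for A B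
    by (simp add: inj_image_subset_iff psubset_eq inj_image_eq_iff)
  have "(*s) fls_X ` \<phi> ` L = \<phi> ` (*s) fls_X ` L" by (simp add: image_image scale)
  then show ?thesis
    using assms(1) residue_field_quotient_image[OF _ inv add scale]
    unfolding elementary_pair_def by (simp add: sub)
qed

lemma elementary_pair_matrix:
  assumes "invertible g" "elementary_pair L L'"
  shows "elementary_pair ((*v) g ` L) ((*v) g ` L')"
proof -
  obtain h where "h ** g = mat 1" using assms(1) unfolding invertible_def by blast
  from inverse_cancel[OF this] show ?thesis
    by (rule elementary_pair_image[OF assms(2), of "(*v) h" "(*v) g"])
      (simp_all add: matrix_vector_right_distrib matrix_vector_scalar)
qed

lemma elementary_pair_scale:
  assumes "c \<noteq> 0" "elementary_pair L L'"
  shows "elementary_pair ((*s) c ` L) ((*s) c ` L')"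
  using assms
  by (intro elementary_pair_image[OF assms(2), of "(*s) (inverse c)" "(*s) c"])
     (simp_all add: vector_smult_assoc vector_add_ldistrib mult.commute)

lemma adjacent_act:
  assumes "invertible g" "adjacent (vertex_of h) (vertex_of h')" "invertible h" "invertible h'"
  shows "adjacent (vertex_of (g ** h)) (vertex_of (g ** h'))"
proof -
  obtain L L' where L: "L \<in> vertex_of h" "L' \<in> vertex_of h'" "elementary_pair L L'"
    using assms(2) unfolding adjacent_elementary_pair by blast
  have "(*v) g ` M \<in> vertex_of (g ** k)" if "M \<in> vertex_of k" for M k
    unfolding act_vertex_of[symmetric] act_def using that by blast
  then show ?thesis
    using elementary_pair_matrix[OF assms(1) L(3)] L(1,2) assms
    unfolding adjacent_elementary_pair
    by (auto intro!: vertex_of_in_vertices invertible_mult)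
qed

text \<open>The matrices of the steps from \<open>[\<O>\<^sup>2]\<close> to its neighbours, chosen upper triangular so that they
  are compatible with the parent map introduced below: \<open>up_step\<close> leads to the parent and the
  \<open>down_step b\<close> lead to the children.\<close>

definition up_step :: "'a::field fls ^ 2 ^ 2" where
  "up_step = mat2 fls_X_inv 0 0 1"

definition down_step :: "'a::field \<Rightarrow> 'a fls ^ 2 ^ 2" where
  "down_step b = mat2 fls_X (fls_const b) 0 1"

lemma invertible_steps [simp]: "invertible up_step" "invertible (down_step b)"
  by (simp_all add: up_step_def down_step_def invertible_mat2_upper)

lemma up_down_step: "up_step ** down_step 0 = mat 1" "down_step 0 ** up_step = mat 1"
  by (simp_all add: up_step_def down_step_def mat2_mult mat_1_mat2)

lemma up_step_lattice:
  "(*s) fls_X ` (*v) up_step ` std_lattice = {v \<in> std_lattice. v $ 2 $$ 0 = 0}"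
proof (intro equalityI subsetI)
  fix v :: "'a fls ^ 2" assume "v \<in> (*s) fls_X ` (*v) up_step ` std_lattice"
  then show "v \<in> {v \<in> std_lattice. v $ 2 $$ 0 = 0}"
    by (auto simp: up_step_def std_lattice_iff)
next
  fix v :: "'a fls ^ 2" assume v: "v \<in> {v \<in> std_lattice. v $ 2 $$ 0 = 0}"
  have "v = fls_X *s (up_step *v vector [v $ 1, fls_X_inv * v $ 2])"
    by (simp add: up_step_def vec2_eq_iff)
  moreover have "vector [v $ 1, fls_X_inv * v $ 2] \<in> std_lattice"
    using v by (simp add: std_lattice_iff int_ring_residue_0)
  ultimately show "v \<in> (*s) fls_X ` (*v) up_step ` std_lattice" by blast
qed

lemma down_step_lattice:
  "(*v) (down_step b) ` std_lattice = {v \<in> std_lattice. v $ 1 $$ 0 = b * v $ 2 $$ 0}"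
proof (intro equalityI subsetI)
  fix v :: "'a fls ^ 2" assume "v \<in> (*v) (down_step b) ` std_lattice"
  then show "v \<in> {v \<in> std_lattice. v $ 1 $$ 0 = b * v $ 2 $$ 0}"
    by (auto simp: down_step_def std_lattice_iff)
next
  fix v :: "'a fls ^ 2" assume v: "v \<in> {v \<in> std_lattice. v $ 1 $$ 0 = b * v $ 2 $$ 0}"
  let ?w = "v $ 1 + - (fls_const b * v $ 2)"
  have "v = down_step b *v vector [fls_X_inv * ?w, v $ 2]"
    by (simp add: down_step_def vec2_eq_iff)
  moreover have "vector [fls_X_inv * ?w, v $ 2] \<in> std_lattice"
    using v int_ring_add[of "v $ 1" "- (fls_const b * v $ 2)"]
    by (auto simp: std_lattice_iff intro!: int_ring_residue_0)
  ultimately show "v \<in> (*v) (down_step b) ` std_lattice" by blast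
qed

text \<open>A sublattice with residue field quotient is the kernel of a nonzero linear form
  \<open>(\<alpha>, \<beta>)\<close> on the reduction \<open>F\<^sub>q\<^sup>2\<close> of \<open>\<O>\<^sup>2\<close>, and such a kernel depends only on
  the point \<open>(\<alpha> : \<beta>)\<close> of the projective line.  The point \<open>(0 : 1)\<close> gives the upward step,
  the point \<open>(1 : -b)\<close> gives the downward step with parameter \<open>b\<close>.\<close>

lemma kernel_pair:
  fixes \<alpha> \<beta> :: "'a::field"
  assumes "\<alpha> \<noteq> 0 \<or> \<beta> \<noteq> 0"
  shows "elementary_pair std_lattice {v \<in> std_lattice. \<alpha> * v $ 1 $$ 0 + \<beta> * v $ 2 $$ 0 = 0}"
    (is "elementary_pair _ ?K")
proof -
  define f where "f = (\<lambda>v :: 'a fls ^ 2. \<alpha> * v $ 1 $$ 0 + \<beta> * v $ 2 $$ 0)"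
  have mem: "vector [fls_const a, fls_const b] \<in> (std_lattice :: ('a fls ^ 2) set)" for a b
    by (simp add: std_lattice_iff)
  have fc: "f (vector [fls_const a, fls_const b]) = \<alpha> * a + \<beta> * b" for a b
    by (simp add: f_def)
  have "\<exists>v\<in>std_lattice. f v = a" for a
  proof (cases "\<alpha> = 0")
    case True
    then show ?thesis using assms by (intro bexI[OF _ mem[of 0 "a / \<beta>"]]) (auto simp only: fc, simp)
  next
    case False
    then show ?thesis by (intro bexI[OF _ mem[of "a / \<alpha>" 0]]) (simp only: fc, simp)
  qed
  then have surj: "f ` std_lattice = UNIV" by (metis UNIV_eq_I image_eqI)
  have lin: "f (c *s v) = c $$ 0 * f v" if "c \<in> int_ring" "v \<in> std_lattice" for c v
    using that by (simp add: f_def std_lattice_iff residue_mult algebra_simps)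
  have "quotient_is_residue_field std_lattice ?K"
    unfolding quotient_is_residue_field_def using surj lin
    by (intro exI[of _ f]) (auto simp: f_def algebra_simps)
  moreover have "?K \<subset> std_lattice"
  proof -
    obtain v where "v \<in> std_lattice" "f v = 1" using surj by (metis UNIV_I imageE)
    then have "v \<in> std_lattice" "v \<notin> ?K" by (simp_all add: f_def)
    then show ?thesis by blast
  qed
  moreover have "(*s) fls_X ` std_lattice \<subset> ?K"
  proof
    show "(*s) fls_X ` std_lattice \<subseteq> ?K" by (auto simp: std_lattice_iff)
    let ?v = "vector [fls_const \<beta>, fls_const (- \<alpha>)] :: 'a fls ^ 2"
    have "?v \<in> ?K" using mem[of \<beta> "- \<alpha>"] by simp
    moreover have "?v \<notin> (*s) fls_X ` std_lattice"
    proof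
      assume "?v \<in> (*s) fls_X ` std_lattice"
      then obtain w where w: "w \<in> std_lattice" "?v = fls_X *s w" by blast
      then have "?v $ i $$ 0 = 0" for i
        using exhaust_2[of i] by (auto simp: std_lattice_iff)
      from this[of 1] this[of 2] show False using assms by simp
    qed
    ultimately show "(*s) fls_X ` std_lattice \<noteq> ?K" by blast
  qed
  ultimately show ?thesis unfolding elementary_pair_def by blast
qed

lemma elementary_pair_std:
  assumes "elementary_pair std_lattice L'"
  shows "L' = (*s) fls_X ` (*v) up_step ` std_lattice \<or>
    (\<exists>b. L' = (*v) (down_step b) ` std_lattice)"
proof -
  obtain f where f: "\<forall>v\<in>std_lattice. \<forall>w\<in>std_lattice. f (v + w) = f v + f w"
    "\<forall>c\<in>int_ring. \<forall>v\<in>std_lattice. f (c *s v) = fls_nth c 0 * f v"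
    "f ` std_lattice = UNIV" "{v\<in>std_lattice. f v = 0} = L'"
    using assms unfolding elementary_pair_def quotient_is_residue_field_def by blast
  define e1 e2 :: "'a fls ^ 2" where "e1 = vector [1, 0]" and "e2 = vector [0, 1]"
  have e: "e1 \<in> std_lattice" "e2 \<in> std_lattice" by (simp_all add: e1_def e2_def std_lattice_iff)
  have f_eq: "f v = v $ 1 $$ 0 * f e1 + v $ 2 $$ 0 * f e2" if "v \<in> std_lattice" for v
  proof -
    have "v = v $ 1 *s e1 + v $ 2 *s e2" by (simp add: vec2_eq_iff e1_def e2_def)
    moreover have "v $ 1 *s e1 \<in> std_lattice" "v $ 2 *s e2 \<in> std_lattice"
      using that e by (auto simp: std_lattice_iff)
    ultimately show ?thesis using f(1,2) e that by (metis std_lattice_iff)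
  qed
  show ?thesis
  proof (cases "f e1 = 0")
    case True
    have "f e2 \<noteq> 0"
    proof
      assume "f e2 = 0"
      then have "f v = 0" if "v \<in> std_lattice" for v using f_eq[OF that] True by simp
      moreover obtain v where "v \<in> std_lattice" "f v = 1" using f(3) by (metis UNIV_I imageE)
      ultimately show False by simp
    qed
    then have "L' = {v \<in> std_lattice. v $ 2 $$ 0 = 0}" using True f_eq f(4) by auto
    then show ?thesis by (simp add: up_step_lattice)
  next
    case False
    have "L' = {v \<in> std_lattice. v $ 1 $$ 0 = (- f e2 / f e1) * v $ 2 $$ 0}"
      unfolding f(4)[symmetric] using False
      by (intro Collect_cong conj_cong refl) (simp add: f_eq field_simps eq_neg_iff_add_eq_0)
    then show ?thesis unfolding down_step_lattice[symmetric] by blast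
  qed
qed

text \<open>Both directions are reduced to the lattice \<open>\<O>\<^sup>2\<close> by translation with \<open>g\<close> and a scalar.\<close>

lemma adjacent_iff_step:
  assumes "invertible g"
  shows "adjacent (vertex_of g) y \<longleftrightarrow>
    y = vertex_of (g ** up_step) \<or> (\<exists>b. y = vertex_of (g ** down_step b))"
proof
  assume "adjacent (vertex_of g) y"
  then obtain L L' where L: "L \<in> vertex_of g" "L' \<in> y" "elementary_pair L L'" "y \<in> vertices"
    unfolding adjacent_elementary_pair by blast
  obtain g' where g': "g' ** g = mat 1" "g ** g' = mat 1"
    using assms unfolding invertible_def by blast
  have "invertible g'" unfolding invertible_def using g' by blast
  obtain c where c: "c \<noteq> 0" "L = (*s) c ` (*v) g ` std_lattice"
    using L(1) unfolding vertex_of_def homothety_class_def by blast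
  define M where "M = (*s) (inverse c) ` (*v) g' ` L'"
  have "elementary_pair ((*s) (inverse c) ` (*v) g' ` L) M"
    unfolding M_def using L c \<open>invertible g'\<close>
    by (intro elementary_pair_scale elementary_pair_matrix) auto
  moreover have "(*s) (inverse c) ` (*v) g' ` L = std_lattice"
    using c g' by (simp add: scale_matrix_image matrix_matrix_image scale_cancel)
  ultimately have "elementary_pair std_lattice M" by simp
  then have M: "M = (*s) fls_X ` (*v) up_step ` std_lattice \<or>
      (\<exists>b. M = (*v) (down_step b) ` std_lattice)"
    by (rule elementary_pair_std)
  have L': "L' = (*s) c ` (*v) g ` M"
    using c g' by (simp add: M_def scale_matrix_image matrix_matrix_image scale_cancel)
  have y: "y = homothety_class L'"
    using L(2,4) homothety_class_mem unfolding vertices_def by fastforce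
  have "y = act g (homothety_class M)"
    unfolding y act_homothety_class homothety_class_eq_iff using L' c(1) by blast
  moreover have "homothety_class M = vertex_of up_step \<or> (\<exists>b. homothety_class M = vertex_of (down_step b))"
    using M
  proof
    assume "M = (*s) fls_X ` (*v) up_step ` std_lattice"
    then have "homothety_class M = vertex_of up_step"
      unfolding vertex_of_def homothety_class_eq_iff by (intro exI[of _ fls_X]) simp
    then show ?thesis ..
  qed (auto simp: vertex_of_def)
  ultimately show "y = vertex_of (g ** up_step) \<or> (\<exists>b. y = vertex_of (g ** down_step b))"
    by (metis act_vertex_of)
next
  have *: "adjacent (vertex_of (mat 1)) (vertex_of h)"
    if h: "invertible h" "d \<noteq> 0" "(*s) d ` (*v) h ` std_lattice = {v \<in> std_lattice. \<alpha> * v $ 1 $$ 0 + \<beta> * v $ 2 $$ 0 = 0}"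
      "\<alpha> \<noteq> 0 \<or> \<beta> \<noteq> 0" for h :: "'a fls ^ 2 ^ 2" and d \<alpha> \<beta>
  proof -
    have "elementary_pair ((*v) (mat 1) ` std_lattice) ((*s) d ` (*v) h ` std_lattice)"
      using kernel_pair[OF h(4)] h(3) by simp
    moreover have "(*s) d ` (*v) h ` std_lattice \<in> vertex_of h"
      using h(2) unfolding vertex_of_def homothety_class_def by blast
    moreover have "(*v) (mat 1) ` std_lattice \<in> vertex_of (mat 1 :: 'a fls ^ 2 ^ 2)"
      unfolding vertex_of_def by (rule homothety_class_self)
    moreover have "invertible (mat 1 :: 'a fls ^ 2 ^ 2)" unfolding invertible_def by auto
    ultimately show ?thesis
      unfolding adjacent_elementary_pair using h(1) vertex_of_in_vertices by blast
  qed
  have up: "adjacent (vertex_of (mat 1)) (vertex_of (up_step :: 'a fls ^ 2 ^ 2))"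
    by (rule *[of _ fls_X 0 1]) (simp_all add: up_step_lattice)
  have down: "adjacent (vertex_of (mat 1)) (vertex_of (down_step b :: 'a fls ^ 2 ^ 2))" for b
    by (rule *[of _ 1 1 "-b"]) (simp_all add: down_step_lattice)
  have "invertible (mat 1 :: 'a fls ^ 2 ^ 2)" unfolding invertible_def by auto
  assume "y = vertex_of (g ** up_step) \<or> (\<exists>b. y = vertex_of (g ** down_step b))"
  then show "adjacent (vertex_of g) y"
    using adjacent_act[OF assms up] adjacent_act[OF assms down] \<open>invertible (mat 1)\<close> by auto
qed

text \<open>All sublattices considered are primitive in \<open>\<O>\<^sup>2\<close>: contained in it, and containing a
  vector that does not vanish modulo \<open>\<pi>\<close>.  Homothetic primitive sublattices coincide, which
  turns equality of classes into equality of lattices.\<close>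

definition primitive :: "('a::field fls ^ 2) set \<Rightarrow> bool" where
  "primitive M \<longleftrightarrow> M \<subseteq> std_lattice \<and> (\<exists>v\<in>M. v $ 1 $$ 0 \<noteq> 0 \<or> v $ 2 $$ 0 \<noteq> 0) \<and>
     (\<forall>c\<in>int_ring. \<forall>v\<in>M. c *s v \<in> M)"

lemma primitive_scalar:
  assumes "primitive M" "(*s) c ` M \<subseteq> std_lattice"
  shows "c \<in> int_ring"
proof -
  obtain v where v: "v \<in> M" "v $ 1 $$ 0 \<noteq> 0 \<or> v $ 2 $$ 0 \<noteq> 0"
    using assms unfolding primitive_def by blast
  then have "v \<in> std_lattice" "c *s v \<in> std_lattice" using assms unfolding primitive_def by auto
  then show ?thesis using v int_ring_cancel_unit by (auto simp: std_lattice_iff)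
qed

lemma primitive_homothetic_eq:
  assumes M: "primitive M" "primitive M'" and c: "c \<noteq> 0" "M = (*s) c ` M'"
  shows "M = M'"
proof -
  have M': "M' = (*s) (inverse c) ` M" using c by (simp add: scale_cancel)
  have "c \<in> int_ring"
    using primitive_scalar[OF M(2), of c] M(1) c by (simp add: primitive_def)
  moreover have "inverse c \<in> int_ring"
    using primitive_scalar[OF M(1), of "inverse c"] M(2) M' by (simp add: primitive_def)
  moreover have "(*s) d ` N \<subseteq> N" if "primitive N" "d \<in> int_ring" for d N
    using that unfolding primitive_def by (intro image_subsetI) simp
  ultimately have "(*s) c ` M' \<subseteq> M'" "(*s) (inverse c) ` M \<subseteq> M" using M by simp_all
  then show ?thesis unfolding c(2)[symmetric] M'[symmetric] by (rule equalityI)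
qed

lemma homothety_class_primitive_eq:
  assumes "homothety_class M = homothety_class M'" "primitive M" "primitive M'"
  shows "M = M'"
  using assms primitive_homothetic_eq unfolding homothety_class_eq_iff by blast

lemma primitive_matrix:
  assumes "\<And>i j. g $ i $ j \<in> int_ring" "g $ 1 $ j $$ 0 \<noteq> 0 \<or> g $ 2 $ j $$ 0 \<noteq> 0"
  shows "primitive ((*v) g ` std_lattice)"
proof -
  define e :: "'a fls ^ 2" where "e = (\<chi> i. if i = j then 1 else 0)"
  have "e \<in> std_lattice" by (simp add: e_def std_lattice_iff)
  moreover have "(g *v e) $ i = g $ i $ j" for i
    using exhaust_2[of j] by (auto simp: e_def matrix_vector_mult_def sum_2)
  ultimately have "\<exists>v\<in>(*v) g ` std_lattice. v $ 1 $$ 0 \<noteq> 0 \<or> v $ 2 $$ 0 \<noteq> 0"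
    using assms(2) by (intro bexI[of _ "g *v e"]) simp_all
  moreover have "c *s (g *v v) \<in> (*v) g ` std_lattice" if "c \<in> int_ring" "v \<in> std_lattice" for c v
    using std_lattice_scale[OF that] unfolding matrix_vector_scalar[symmetric] by (rule imageI)
  ultimately show ?thesis
    using integral_matrix_image[OF assms(1)] unfolding primitive_def by blast
qed

lemma vertex_of_steps_distinct:
  "vertex_of (down_step b) = vertex_of (down_step b') \<Longrightarrow> b = b'"
  "vertex_of (down_step b) \<noteq> vertex_of up_step"
proof -
  have down: "primitive ((*v) (down_step b) ` std_lattice)" for b :: 'a
    by (rule primitive_matrix[where j = 2]) (simp_all add: down_step_def mat2_integral)
  (* a primitive representative of the class of up_step *)
  define U where "U = mat2 1 0 0 (fls_X :: 'a fls)"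
  have U: "vertex_of U = vertex_of up_step"
    using vertex_of_scale[of fls_X up_step] by (simp add: U_def up_step_def mat2_mult)
  have up: "primitive ((*v) U ` std_lattice)"
    by (rule primitive_matrix[where j = 1]) (simp_all add: U_def mat2_integral)
  have mem: "vector [fls_const b, 1] \<in> (*v) (down_step b) ` std_lattice" for b :: 'a
    by (simp add: down_step_lattice std_lattice_iff)
  show "b = b'" if "vertex_of (down_step b) = vertex_of (down_step b')"
  proof -
    from that have "(*v) (down_step b) ` std_lattice = (*v) (down_step b') ` std_lattice"
      unfolding vertex_of_def by (rule homothety_class_primitive_eq) (rule down)+
    with mem[of b] have "vector [fls_const b, 1] \<in> (*v) (down_step b') ` std_lattice" by simp
    then show "b = b'" by (simp add: down_step_lattice)
  qed
  show "vertex_of (down_step b) \<noteq> vertex_of up_step"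
  proof
    assume "vertex_of (down_step b) = vertex_of up_step"
    then have "homothety_class ((*v) (down_step b) ` std_lattice) = homothety_class ((*v) U ` std_lattice)"
      using U unfolding vertex_of_def by simp
    from homothety_class_primitive_eq[OF this down up] mem[of b]
    have "vector [fls_const b, 1] \<in> (*v) U ` std_lattice" by simp
    then obtain w :: "'a fls ^ 2" where "w \<in> std_lattice" "1 = fls_X * w $ 2"
      by (auto simp: U_def vec2_eq_iff)
    then have "(1 :: 'a fls) $$ 0 = 0" by (metis residue_X_mult std_lattice_iff)
    then show False by simp
  qed
qed

section \<open>The parent of a vertex\<close>

text \<open>The tree is hung from the end of the boundary fixed by the upper triangular matrices,
  that is, from the line \<open>F e\<^sub>1\<close>: the parent lattice of \<open>L\<close> is
  \<open>L + \<pi>\<^sup>-\<^sup>1 (L \<inter> F e\<^sub>1)\<close>.  Upper triangular matrices commute with this construction.\<close>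

definition parent_lattice :: "('a::field fls ^ 2) set \<Rightarrow> ('a fls ^ 2) set" where
  "parent_lattice L = {v + w | v w. v \<in> L \<and> w $ 2 = 0 \<and> fls_X *s w \<in> L}"

definition parent :: "'a::field vertex \<Rightarrow> 'a vertex" where
  "parent x = parent_lattice ` x"

definition upper_triangular :: "'a::field fls ^ 2 ^ 2 \<Rightarrow> bool" where
  "upper_triangular h \<longleftrightarrow> invertible h \<and> h $ 2 $ 1 = 0"

lemma upper_triangular_diagonal:
  assumes "upper_triangular h" shows "h $ 1 $ 1 \<noteq> 0" "h $ 2 $ 2 \<noteq> 0"
proof -
  obtain k where k: "h ** k = mat 1" "k ** h = mat 1" "h $ 2 $ 1 = 0"
    using assms unfolding upper_triangular_def invertible_def by blast
  have "(h ** k) $ 2 $ 2 = 1" "(k ** h) $ 1 $ 1 = 1" using k by (simp_all add: mat_def)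
  then show "h $ 1 $ 1 \<noteq> 0" "h $ 2 $ 2 \<noteq> 0"
    using k(3) by (auto simp: matrix_matrix_mult_def sum_2)
qed

lemma upper_triangular_mult:
  "upper_triangular g \<Longrightarrow> upper_triangular h \<Longrightarrow> upper_triangular (g ** h)"
  unfolding upper_triangular_def
  by (auto intro: invertible_mult) (simp add: matrix_matrix_mult_def sum_2)

lemma upper_triangular_mat2:
  "a \<noteq> 0 \<Longrightarrow> d \<noteq> 0 \<Longrightarrow> upper_triangular (mat2 a b 0 d)"
  by (simp add: upper_triangular_def invertible_mat2_upper)

lemma parent_lattice_image:
  assumes "upper_triangular g"
  shows "parent_lattice ((*v) g ` L) = (*v) g ` parent_lattice L"
proof (intro equalityI subsetI)
  fix x assume "x \<in> parent_lattice ((*v) g ` L)"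
  then obtain v w u where x: "x = g *v v + w" "v \<in> L" "w $ 2 = 0" "fls_X *s w = g *v u" "u \<in> L"
    unfolding parent_lattice_def by blast
  have "w = fls_X_inv *s (fls_X *s w)" by (simp add: vector_smult_assoc)
  then have w: "w = g *v (fls_X_inv *s u)" using x(4) by (simp add: matrix_vector_scalar)
  have "(g *v u) $ 2 = 0" using x(3) unfolding x(4)[symmetric] by simp
  then have "u $ 2 = 0"
    using assms upper_triangular_diagonal[OF assms]
    by (simp add: upper_triangular_def matrix_vector_mult_def sum_2)
  moreover have "x = g *v (v + fls_X_inv *s u)"
    using x(1) w by (simp add: matrix_vector_right_distrib)
  moreover have "v + fls_X_inv *s u \<in> parent_lattice L"
    if "u $ 2 = 0" unfolding parent_lattice_def using x(2,5) that
    by (intro CollectI exI[of _ v] exI[of _ "fls_X_inv *s u"]) (simp add: vector_smult_assoc)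
  ultimately show "x \<in> (*v) g ` parent_lattice L" by blast
next
  fix x assume "x \<in> (*v) g ` parent_lattice L"
  then obtain v w where x: "x = g *v v + g *v w" "v \<in> L" "w $ 2 = 0" "fls_X *s w \<in> L"
    unfolding parent_lattice_def by (auto simp: matrix_vector_right_distrib)
  have "(g *v w) $ 2 = 0"
    using assms x(3) by (simp add: upper_triangular_def matrix_vector_mult_def sum_2)
  then show "x \<in> parent_lattice ((*v) g ` L)"
    unfolding parent_lattice_def using x
    by (intro CollectI exI[of _ "g *v v"] exI[of _ "g *v w"]) (simp flip: matrix_vector_scalar)
qed

lemma parent_lattice_std: "parent_lattice std_lattice = (*v) up_step ` std_lattice"
proof (intro equalityI subsetI)
  fix x :: "'a fls ^ 2" assume "x \<in> parent_lattice std_lattice"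
  then obtain v w where x: "x = v + w" "v \<in> std_lattice" "w $ 2 = 0" "fls_X *s w \<in> std_lattice"
    unfolding parent_lattice_def by blast
  have "x = up_step *v (vector [fls_X * v $ 1 + fls_X * w $ 1, v $ 2])"
    using x by (simp add: up_step_def vec2_eq_iff distrib_left)
  moreover have "vector [fls_X * v $ 1 + fls_X * w $ 1, v $ 2] \<in> std_lattice"
    using x by (simp add: std_lattice_iff)
  ultimately show "x \<in> (*v) up_step ` std_lattice" by blast
next
  fix x :: "'a fls ^ 2" assume "x \<in> (*v) up_step ` std_lattice"
  then obtain u where u: "u \<in> std_lattice" "x = up_step *v u" by blast
  have "x = vector [0, u $ 2] + vector [fls_X_inv * u $ 1, 0]"
    by (simp add: u up_step_def vec2_eq_iff)
  moreover have "vector [0, u $ 2] \<in> std_lattice"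
    "fls_X *s vector [fls_X_inv * u $ 1, 0] \<in> std_lattice"
    using u by (simp_all add: std_lattice_iff)
  ultimately show "x \<in> parent_lattice std_lattice"
    unfolding parent_lattice_def
    by (intro CollectI exI[of _ "vector [0, u $ 2]"] exI[of _ "vector [fls_X_inv * u $ 1, 0]"]) simp
qed

lemma parent_homothety_class: "parent (homothety_class L) = homothety_class (parent_lattice L)"
proof -
  have "parent_lattice ((*s) c ` L) = (*s) c ` parent_lattice L" if "c \<noteq> 0" for c
    using parent_lattice_image[OF upper_triangular_mat2[OF that that], of 0 L]
    by (simp add: scalar_as_matrix)
  then show ?thesis
    unfolding parent_def homothety_class_image image_image by (intro image_cong) simp_all
qed

lemma parent_vertex_of:
  "upper_triangular h \<Longrightarrow> parent (vertex_of h) = vertex_of (h ** up_step)"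
  unfolding vertex_of_def parent_homothety_class
  by (simp add: parent_lattice_image parent_lattice_std matrix_matrix_image)

lemma upper_triangular_steps [simp]: "upper_triangular up_step" "upper_triangular (down_step b)"
  by (simp_all add: up_step_def down_step_def upper_triangular_mat2)

text \<open>This is the Iwasawa decomposition.  One of the two entries in the last row of a matrix divides the other
  in \<open>\<O>\<close>, and a column operation over \<open>\<O>\<close> removes the multiple.\<close>

lemma vertex_of_upper_triangular:
  fixes x :: "'a::field vertex"
  assumes "x \<in> vertices"
  obtains h where "upper_triangular h" "x = vertex_of h"
proof -
  obtain g where g: "invertible g" "x = vertex_of g" using assms vertices_eq by blast
  note found = that
  have red: thesis if k: "\<And>i j. k $ i $ j \<in> int_ring" "\<And>i j. k' $ i $ j \<in> int_ring"
      "k ** k' = mat 1" "k' ** k = mat 1" "(g ** k) $ 2 $ 1 = 0" for k k' :: "'a fls ^ 2 ^ 2"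
  proof (rule found)
    show "x = vertex_of (g ** k)" using vertex_of_right_unit[OF k(1,2,3)] g(2) by simp
    have "invertible k" unfolding invertible_def using k by blast
    then show "upper_triangular (g ** k)"
      using g(1) k(5) by (simp add: upper_triangular_def invertible_mult)
  qed
  define c d where "c = g $ 2 $ 1" and "d = g $ 2 $ 2"
  have last_row: "(g ** k) $ 2 $ 1 = c * k $ 1 $ 1 + d * k $ 2 $ 1" for k :: "'a fls ^ 2 ^ 2"
    by (simp add: matrix_matrix_mult_def sum_2 c_def d_def)
  show ?thesis
  proof (cases "c = 0 \<or> d \<noteq> 0 \<and> fls_subdegree d \<le> fls_subdegree c")
    case True
    then have *: "c / d \<in> int_ring"
      by (cases "c = 0") (auto simp: int_ring_iff fls_divide_subdegree)
    show ?thesis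
    proof (rule red)
      show "mat2 1 0 (- (c / d)) 1 $ i $ j \<in> int_ring" "mat2 1 0 (c / d) 1 $ i $ j \<in> int_ring" for i j
        using * by (auto intro: mat2_integral)
      show "(g ** mat2 1 0 (- (c / d)) 1) $ 2 $ 1 = 0" using True by (auto simp: last_row)
    qed (simp_all add: mat2_mult mat_1_mat2)
  next
    case False
    then have *: "d / c \<in> int_ring"
      by (cases "d = 0") (auto simp: int_ring_iff fls_divide_subdegree)
    show ?thesis
    proof (rule red)
      show "mat2 (- (d / c)) 1 1 0 $ i $ j \<in> int_ring" "mat2 0 1 1 (d / c) $ i $ j \<in> int_ring" for i j
        using * by (auto intro: mat2_integral)
      show "(g ** mat2 (- (d / c)) 1 1 0) $ 2 $ 1 = 0" using False by (simp add: last_row)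
    qed (simp_all add: mat2_mult mat_1_mat2)
  qed
qed

lemma vertex_of_down_up: "vertex_of (g ** down_step b ** up_step) = vertex_of g"
proof -
  have "down_step b ** up_step = mat2 1 (fls_const b) 0 1"
    by (simp add: down_step_def up_step_def mat2_mult)
  moreover have "vertex_of (g ** mat2 1 (fls_const b) 0 1) = vertex_of g"
    by (rule vertex_of_right_unit[where k' = "mat2 1 (- fls_const b) 0 1"])
       (auto intro: mat2_integral simp: mat2_mult mat_1_mat2)
  ultimately show ?thesis by (simp flip: matrix_mul_assoc)
qed

lemma adjacent_vertices: "adjacent x y \<Longrightarrow> x \<in> vertices" "adjacent x y \<Longrightarrow> y \<in> vertices"
  by (simp_all add: adjacent_def)

lemma adjacent_sym:
  assumes "adjacent x y" shows "adjacent y x"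
proof -
  obtain g where g: "invertible g" "x = vertex_of g"
    using adjacent_vertices(1)[OF assms] vertices_eq[of x] by blast
  from assms[unfolded g(2) adjacent_iff_step[OF g(1)]] show ?thesis
  proof (elim disjE exE)
    assume y: "y = vertex_of (g ** up_step)"
    have "x = vertex_of (g ** up_step ** down_step 0)"
      by (simp add: g up_down_step flip: matrix_mul_assoc)
    then show ?thesis unfolding y using g(1) by (subst adjacent_iff_step) (auto intro: invertible_mult)
  next
    fix b assume y: "y = vertex_of (g ** down_step b)"
    show ?thesis unfolding y using g
      by (subst adjacent_iff_step) (auto intro: invertible_mult simp: vertex_of_down_up)
  qed
qed

lemma adjacent_parent_cases:
  assumes "adjacent x y" shows "y = parent x \<or> x = parent y"
proof -
  obtain h where h: "upper_triangular h" "x = vertex_of h"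
    using vertex_of_upper_triangular[OF adjacent_vertices(1)[OF assms]] by metis
  then have "invertible h" by (simp add: upper_triangular_def)
  from assms[unfolded h(2) adjacent_iff_step[OF this]] show ?thesis
    using h by (auto simp: parent_vertex_of upper_triangular_mult vertex_of_down_up)
qed

definition ray_matrix :: "nat \<Rightarrow> 'a::field fls ^ 2 ^ 2" where
  "ray_matrix n = mat2 (fls_X_inv ^ n) 0 0 1"

lemma ray_matrix_Suc: "ray_matrix n ** up_step = ray_matrix (Suc n)"
  by (simp add: ray_matrix_def up_step_def mat2_mult power_commutes)

lemma upper_triangular_ray_matrix [simp]: "upper_triangular (ray_matrix n)"
  by (simp add: ray_matrix_def upper_triangular_mat2)

lemma parent_power_vertex_of:
  "upper_triangular h \<Longrightarrow> (parent ^^ j) (vertex_of h) = vertex_of (h ** ray_matrix j)"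
proof (induction j)
  case 0
  then show ?case by (simp add: ray_matrix_def flip: mat_1_mat2)
next
  case (Suc j)
  then show ?case
    by (simp add: parent_vertex_of upper_triangular_mult ray_matrix_Suc flip: matrix_mul_assoc)
qed

lemma parent_aperiodic:
  fixes x :: "'a::field vertex"
  assumes "x \<in> vertices" "(parent ^^ j) x = x"
  shows "j = 0"
proof (rule ccontr)
  assume "j \<noteq> 0"
  obtain h where h: "upper_triangular h" "x = vertex_of h"
    using vertex_of_upper_triangular[OF assms(1)] by metis
  then have "vertex_of (h ** ray_matrix j) = vertex_of (h ** mat 1)"
    using assms(2) by (simp add: parent_power_vertex_of)
  then have "vertex_of (ray_matrix j) = vertex_of (mat 1 :: 'a fls ^ 2 ^ 2)"
    using h(1) vertex_of_left_cancel unfolding upper_triangular_def by blast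
  moreover define U where "U = mat2 1 0 0 (fls_X ^ j :: 'a fls)"
  have "fls_X ^ j * fls_X_inv ^ j = (1 :: 'a fls)" by (simp flip: power_mult_distrib)
  then have "vertex_of U = vertex_of (ray_matrix j)"
    using vertex_of_scale[of "fls_X ^ j" "ray_matrix j :: 'a fls ^ 2 ^ 2"]
    by (simp add: U_def ray_matrix_def mat2_mult)
  ultimately have "homothety_class ((*v) U ` std_lattice) = homothety_class ((*v) (mat 1) ` std_lattice)"
    unfolding vertex_of_def by simp
  moreover have "fls_X ^ j \<in> (int_ring :: 'a fls set)" by (simp add: int_ring_iff)
  then have "primitive ((*v) U ` std_lattice)"
    by (intro primitive_matrix[where j = 1]) (simp_all add: U_def mat2_integral)
  moreover have "primitive ((*v) (mat 1 :: 'a fls ^ 2 ^ 2) ` std_lattice)"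
    unfolding mat_1_mat2 by (intro primitive_matrix[where j = 1]) (simp_all add: mat2_integral)
  ultimately have eq: "(*v) U ` std_lattice = (*v) (mat 1) ` std_lattice"
    by (rule homothety_class_primitive_eq)
  have "vector [0, 1 :: 'a fls] \<in> std_lattice" by (simp add: std_lattice_iff)
  then have "vector [0, 1] \<in> (*v) U ` std_lattice" by (simp add: eq)
  then obtain w :: "'a fls ^ 2" where "w $ 2 \<in> int_ring" "1 = fls_X ^ j * w $ 2"
    by (auto simp: U_def vec2_eq_iff std_lattice_iff)
  moreover obtain i where "j = Suc i" using \<open>j \<noteq> 0\<close> not0_implies_Suc by blast
  ultimately have "(1 :: 'a fls) = fls_X * (fls_X ^ i * w $ 2)" "fls_X ^ i * w $ 2 \<in> int_ring"
    by (simp_all add: mult.assoc int_ring_iff[of "fls_X ^ i"])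
  then have "(1 :: 'a fls) $$ 0 = 0" by (metis residue_X_mult)
  then show False by simp
qed

section \<open>Non-backtracking paths\<close>

definition nb_path :: "(nat \<Rightarrow> 'a::field vertex) \<Rightarrow> nat \<Rightarrow> bool" where
  "nb_path z n \<longleftrightarrow> (\<forall>i<n. adjacent (z i) (z (Suc i))) \<and> (\<forall>i. i + 2 \<le> n \<longrightarrow> z (i + 2) \<noteq> z i)"

lemma nb_path_Suc:
  "nb_path z (Suc n) \<longleftrightarrow> adjacent (z 0) (z 1) \<and> (n \<ge> 1 \<longrightarrow> z 2 \<noteq> z 0) \<and> nb_path (\<lambda>i. z (Suc i)) n"
proof
  assume "nb_path z (Suc n)"
  then show "adjacent (z 0) (z 1) \<and> (n \<ge> 1 \<longrightarrow> z 2 \<noteq> z 0) \<and> nb_path (\<lambda>i. z (Suc i)) n"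
    unfolding nb_path_def by (fastforce dest: spec[of _ 0] simp: numeral_2_eq_2)
next
  assume *: "adjacent (z 0) (z 1) \<and> (n \<ge> 1 \<longrightarrow> z 2 \<noteq> z 0) \<and> nb_path (\<lambda>i. z (Suc i)) n"
  have "adjacent (z i) (z (Suc i))" if "i < Suc n" for i
    using * that unfolding nb_path_def by (cases i) auto
  moreover have "z (i + 2) \<noteq> z i" if "i + 2 \<le> Suc n" for i
    using * that unfolding nb_path_def by (cases i) (auto simp: numeral_2_eq_2)
  ultimately show "nb_path z (Suc n)" unfolding nb_path_def by blast
qed

text \<open>After a step down the path has to keep descending, because the only way up leads back to where
  it came from.\<close>

lemma nb_path_descending:
  assumes "nb_path z (Suc n)" "z 1 \<noteq> parent (z 0)"
  shows "(parent ^^ n) (z (Suc n)) = z 1"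
  using assms
proof (induction n arbitrary: z)
  case (Suc n)
  from Suc.prems(1) have z: "adjacent (z 0) (z 1)" "z 2 \<noteq> z 0" "nb_path (\<lambda>i. z (Suc i)) (Suc n)"
    by (subst (asm) nb_path_Suc, simp)+
  have "z 0 = parent (z 1)" using adjacent_parent_cases[OF z(1)] Suc.prems(2) by blast
  then have ne: "z 2 \<noteq> parent (z 1)" using z(2) by metis
  have "(parent ^^ n) (z (Suc (Suc n))) = z 2"
    using Suc.IH[OF z(3)] ne by (simp add: numeral_2_eq_2)
  moreover have "z 1 = parent (z 2)"
    using z(3) ne adjacent_parent_cases[of "z 1" "z 2"] by (simp add: nb_path_Suc numeral_2_eq_2)
  ultimately show ?case by simp
qed simp

text \<open>A path of length \<open>n\<close> climbs for \<open>a\<close> steps and then descends, so that its two ends have a common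
  ancestor at distances \<open>a\<close> and \<open>n - a\<close>.\<close>

lemma nb_path_turning_point:
  assumes "nb_path z n"
  shows "\<exists>a\<le>n. (parent ^^ (n - a)) (z n) = (parent ^^ a) (z 0) \<and>
    (n > 0 \<and> z 1 = parent (z 0) \<longrightarrow> a > 0)"
  using assms
proof (induction n arbitrary: z)
  case (Suc n)
  show ?case
  proof (cases "z 1 = parent (z 0)")
    case True
    obtain a where a: "a \<le> n" "(parent ^^ (n - a)) (z (Suc n)) = (parent ^^ a) (z 1)"
      using Suc.IH[of "\<lambda>i. z (Suc i)"] Suc.prems by (auto simp: nb_path_Suc)
    then show ?thesis using True
      by (intro exI[of _ "Suc a"]) (simp add: funpow_swap1)
  next
    case False
    have "adjacent (z 0) (z 1)" using Suc.prems by (simp add: nb_path_Suc)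
    then have "z 0 = parent (z 1)" using adjacent_parent_cases False by blast
    then have "(parent ^^ Suc n) (z (Suc n)) = z 0"
      using nb_path_descending[OF Suc.prems False] by simp
    then show ?thesis using False by (intro exI[of _ 0]) simp
  qed
qed simp

text \<open>This is where the absence of cycles is used.  If one path starts upwards and the other
  downwards, some positive power of the parent map would fix their common start.\<close>

lemma nb_path_first_step_unique:
  assumes z: "nb_path z (Suc n)" and z': "nb_path z' (Suc n)"
    and ends: "z 0 = z' 0" "z (Suc n) = z' (Suc n)"
  shows "z 1 = z' 1"
proof -
  have adj: "adjacent (z 0) (z 1)" "adjacent (z' 0) (z' 1)"
    using z z' by (simp_all add: nb_path_Suc)
  have mixed: False
    if p: "nb_path p (Suc n)" "nb_path p' (Suc n)" "p 0 = p' 0" "p (Suc n) = p' (Suc n)"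
      "p 1 = parent (p 0)" "p' 1 \<noteq> parent (p' 0)" for p p'
  proof -
    obtain a where a: "a \<le> Suc n" "(parent ^^ (Suc n - a)) (p (Suc n)) = (parent ^^ a) (p 0)" "a > 0"
      using nb_path_turning_point[OF p(1)] p(5) by auto
    have adj': "adjacent (p' 0) (p' 1)" using p(2) by (simp add: nb_path_Suc)
    then have "p' 0 = parent (p' 1)" using adjacent_parent_cases p(6) by blast
    then have "(parent ^^ Suc n) (p' (Suc n)) = p' 0"
      using nb_path_descending[OF p(2,6)] by simp
    moreover have "(parent ^^ (a + a)) (p 0) = (parent ^^ (a + (Suc n - a))) (p (Suc n))"
      using a(2) by (simp add: funpow_add)
    ultimately have "(parent ^^ (a + a)) (p 0) = p 0" using a(1) p(3,4) by simp
    moreover have "p 0 \<in> vertices" using adj' p(3) unfolding adjacent_def by simp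
    ultimately show False using parent_aperiodic a(3) by fastforce
  qed
  show ?thesis
  proof (cases "z 1 = parent (z 0)"; cases "z' 1 = parent (z' 0)")
    assume "z 1 \<noteq> parent (z 0)" "z' 1 \<noteq> parent (z' 0)"
    then show ?thesis using nb_path_descending[OF z] nb_path_descending[OF z'] ends by simp
  qed (use mixed[OF z z'] mixed[OF z' z] ends in auto)
qed

section \<open>Descendant shadows\<close>

lemma Desc_nb_path: "Desc N (x, y) = {z (Suc N) | z. z 0 = x \<and> z 1 = y \<and> nb_path z (Suc N)}"
proof -
  have path: "(\<forall>i\<le>N. adjacent (z i) (z (i + 1))) \<and> (\<forall>i<N. z (i + 2) \<noteq> z i) \<longleftrightarrow> nb_path z (Suc N)" for z
  proof -
    have "i < Suc N \<longleftrightarrow> i \<le> N" "i + 2 \<le> Suc N \<longleftrightarrow> i < N" "i + 1 = Suc i" for i by auto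
    then show ?thesis unfolding nb_path_def by (simp only:)
  qed
  show ?thesis unfolding Desc_def fst_conv snd_conv path by (simp only: Suc_eq_plus1)
qed

lemma Desc_0:
  assumes "adjacent x y" shows "Desc 0 (x, y) = {y}"
proof -
  have "nb_path (\<lambda>i. if i = 0 then x else y) (Suc 0)"
    using assms by (simp add: nb_path_def)
  then have "y \<in> Desc 0 (x, y)"
    unfolding Desc_nb_path by (intro CollectI exI[of _ "\<lambda>i. if i = 0 then x else y"]) simp
  moreover have "v = y" if "v \<in> Desc 0 (x, y)" for v
    using that unfolding Desc_nb_path by auto
  ultimately show ?thesis by blast
qed

lemma Desc_Suc:
  assumes "adjacent x y"
  shows "Desc (Suc N) (x, y) = (\<Union>w \<in> {w. adjacent y w} - {x}. Desc N (y, w))"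
proof (intro equalityI subsetI)
  fix v assume "v \<in> Desc (Suc N) (x, y)"
  then obtain z where z: "v = z (Suc (Suc N))" "z 0 = x" "z 1 = y" "nb_path z (Suc (Suc N))"
    unfolding Desc_nb_path by blast
  from z(4) have n: "z 2 \<noteq> z 0" "nb_path (\<lambda>i. z (Suc i)) (Suc N)"
    by (subst (asm) nb_path_Suc, simp)+
  then have "adjacent (z 1) (z 2)" by (simp add: nb_path_Suc numeral_2_eq_2)
  moreover have "v \<in> Desc N (y, z 2)"
    unfolding Desc_nb_path using z n
    by (intro CollectI exI[of _ "\<lambda>i. z (Suc i)"]) (simp add: numeral_2_eq_2)
  ultimately show "v \<in> (\<Union>w \<in> {w. adjacent y w} - {x}. Desc N (y, w))" using z n by auto
next
  fix v assume "v \<in> (\<Union>w \<in> {w. adjacent y w} - {x}. Desc N (y, w))"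
  then obtain w z where z: "adjacent y w" "w \<noteq> x" "v = z (Suc N)" "z 0 = y" "z 1 = w" "nb_path z (Suc N)"
    unfolding Desc_nb_path by blast
  define z' where "z' = (\<lambda>i. case i of 0 \<Rightarrow> x | Suc j \<Rightarrow> z j)"
  have "nb_path z' (Suc (Suc N))"
    unfolding nb_path_Suc[of z'] using z assms by (simp add: z'_def numeral_2_eq_2)
  then show "v \<in> Desc (Suc N) (x, y)"
    unfolding Desc_nb_path using z by (intro CollectI exI[of _ z']) (simp add: z'_def)
qed

text \<open>This is what makes the size of a shadow computable: two edges leaving \<open>y\<close> have no descendant in
  common at equal depth.\<close>

lemma Desc_disjoint:
  assumes "w \<noteq> w'" shows "Desc N (y, w) \<inter> Desc N (y, w') = {}"
proof (rule ccontr)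
  assume "Desc N (y, w) \<inter> Desc N (y, w') \<noteq> {}"
  then obtain z z' where "z 0 = y" "z 1 = w" "nb_path z (Suc N)"
    "z' 0 = y" "z' 1 = w'" "nb_path z' (Suc N)" "z (Suc N) = z' (Suc N)"
    unfolding Desc_nb_path by blast
  with nb_path_first_step_unique[of z N z'] assms show False by simp
qed

section \<open>Heights\<close>

lemma poly_ring_pCons:
  "poly (map_poly fls_const (pCons a p)) fls_X_inv =
   fls_const a + fls_X_inv * poly (map_poly fls_const p) (fls_X_inv :: 'a::field fls)"
  by (simp add: map_poly_pCons)

lemma poly_ring_const [simp]: "fls_const (a :: 'a::field) \<in> poly_ring"
  unfolding poly_ring_def using poly_ring_pCons[of a 0] by (intro range_eqI[of _ _ "[:a:]"]) simp

lemma poly_ring_0_1 [simp]: "0 \<in> (poly_ring :: 'a::field fls set)" "1 \<in> (poly_ring :: 'a fls set)"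
  using poly_ring_const[of "0::'a"] poly_ring_const[of "1::'a"] by simp_all

lemma poly_ring_t [simp]: "fls_X_inv \<in> (poly_ring :: 'a::field fls set)"
  unfolding poly_ring_def using poly_ring_pCons[of "0::'a" 1] by (intro range_eqI[of _ _ "pCons 0 1"]) simp

lemma poly_ring_add [intro]:
  assumes "f \<in> poly_ring" "g \<in> (poly_ring :: 'a::field fls set)" shows "f + g \<in> poly_ring"
proof -
  obtain p r where "f = poly (map_poly fls_const p) fls_X_inv" "g = poly (map_poly fls_const r) fls_X_inv"
    using assms unfolding poly_ring_def by blast
  moreover have "map_poly fls_const (p + r) = map_poly fls_const p + map_poly fls_const r"
    by (intro poly_eqI) (simp add: coeff_map_poly fls_plus_const)
  ultimately show ?thesis unfolding poly_ring_def by (intro range_eqI[of _ _ "p + r"]) simp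
qed

lemma poly_ring_mult [intro]:
  assumes "f \<in> poly_ring" "g \<in> (poly_ring :: 'a::field fls set)" shows "f * g \<in> poly_ring"
proof -
  obtain p where p: "f = poly (map_poly fls_const p) fls_X_inv"
    using assms(1) unfolding poly_ring_def by blast
  have scale: "fls_const a * h \<in> poly_ring" if h: "h \<in> poly_ring" for a and h :: "'a fls"
  proof -
    obtain r where "h = poly (map_poly fls_const r) fls_X_inv"
      using h unfolding poly_ring_def by blast
    moreover have "map_poly fls_const (smult a r) = smult (fls_const a) (map_poly fls_const r)"
      by (rule map_poly_smult) simp_all
    ultimately show ?thesis unfolding poly_ring_def by (intro range_eqI[of _ _ "smult a r"]) simp
  qed
  have shift: "fls_X_inv * h \<in> poly_ring" if h: "h \<in> poly_ring" for h :: "'a fls"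
  proof -
    obtain r where "h = poly (map_poly fls_const r) fls_X_inv"
      using h unfolding poly_ring_def by blast
    then show ?thesis
      unfolding poly_ring_def using poly_ring_pCons[of 0 r]
      by (intro range_eqI[of _ _ "pCons 0 r"]) simp
  qed
  show ?thesis unfolding p
  proof (induction p)
    case (pCons a p)
    have "(fls_const a + fls_X_inv * h) * g = fls_const a * g + fls_X_inv * (h * g)" for h
      by (simp add: algebra_simps)
    then show ?case
      unfolding poly_ring_pCons using scale[OF assms(2)] shift[OF pCons.IH] by auto
  qed simp
qed

lemma poly_ring_power: "f \<in> poly_ring \<Longrightarrow> f ^ n \<in> (poly_ring :: 'a::field fls set)"
  by (induction n) auto

lemma poly_ring_sum_prod:
  "a \<in> poly_ring \<Longrightarrow> b \<in> poly_ring \<Longrightarrow> c \<in> poly_ring \<Longrightarrow> d \<in> poly_ring \<Longrightarrow>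
    a * b + c * d \<in> (poly_ring :: 'a::field fls set)"
  by (intro poly_ring_add poly_ring_mult)

text \<open>A polynomial in \<open>t\<close> has no terms of positive order in \<open>t\<^sup>-\<^sup>1\<close>.\<close>

lemma poly_ring_subdegree:
  assumes "f \<in> (poly_ring :: 'a::field fls set)" shows "fls_subdegree f \<le> 0"
proof (rule ccontr)
  assume pos: "\<not> fls_subdegree f \<le> 0"
  obtain p where p: "f = poly (map_poly fls_const p) fls_X_inv"
    using assms unfolding poly_ring_def by blast
  have "n > 0 \<Longrightarrow> poly (map_poly fls_const p) fls_X_inv $$ n = 0" for n
  proof (induction p arbitrary: n)
    case (pCons a p)
    then show ?case unfolding poly_ring_pCons by (simp add: fls_X_inv_times_conv_shift)
  qed simp
  then have "f $$ fls_subdegree f = 0" using pos p by simp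
  then show False using pos by (auto simp: nth_fls_subdegree_zero_iff)
qed

lemma GL2_polyI:
  assumes "g ** h = mat 1" "h ** g = mat 1" "\<And>i j. g $ i $ j \<in> poly_ring" "\<And>i j. h $ i $ j \<in> poly_ring"
  shows "g \<in> GL2_poly"
  unfolding GL2_poly_def using assms by blast

lemma GL2_polyE:
  assumes "g \<in> GL2_poly"
  obtains h where "h \<in> GL2_poly" "g ** h = mat 1" "h ** g = mat 1"
  using assms unfolding GL2_poly_def by blast

lemma GL2_poly_entries: "g \<in> GL2_poly \<Longrightarrow> g $ i $ j \<in> poly_ring"
  unfolding GL2_poly_def by blast

lemma GL2_poly_invertible: "g \<in> GL2_poly \<Longrightarrow> invertible g"
  unfolding GL2_poly_def invertible_def by blast

lemma GL2_poly_mult: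
  assumes "g \<in> GL2_poly" "h \<in> GL2_poly" shows "g ** h \<in> GL2_poly"
proof -
  obtain g' h' where gh: "g' \<in> GL2_poly" "g ** g' = mat 1" "g' ** g = mat 1"
    "h' \<in> GL2_poly" "h ** h' = mat 1" "h' ** h = mat 1"
    using assms by (metis GL2_polyE)
  have "g ** h ** (h' ** g') = g ** (h ** h') ** g'" "h' ** g' ** (g ** h) = h' ** (g' ** g) ** h"
    by (simp_all add: matrix_mul_assoc)
  then have "g ** h ** (h' ** g') = mat 1" "h' ** g' ** (g ** h) = mat 1" using gh by simp_all
  moreover have "(a ** b) $ i $ j \<in> poly_ring" if "a \<in> GL2_poly" "b \<in> GL2_poly" for a b :: "'a fls ^ 2 ^ 2" and i j
    using that by (simp add: matrix_matrix_mult_def sum_2 poly_ring_sum_prod GL2_poly_entries)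
  ultimately show ?thesis using gh assms by (intro GL2_polyI[where h = "h' ** g'"])
qed

lemma mat2_poly:
  assumes "a \<in> poly_ring" "b \<in> poly_ring" "c \<in> poly_ring" "d \<in> poly_ring"
  shows "mat2 a b c d $ i $ j \<in> poly_ring"
  using assms exhaust_2[of i] exhaust_2[of j] by auto

lemma unipotent_GL2_poly:
  assumes "p \<in> poly_ring" shows "mat2 1 p 0 1 \<in> GL2_poly"
proof (rule GL2_polyI)
  have "- p = fls_const (- 1) * p" by simp
  also have "\<dots> \<in> poly_ring" using assms by (intro poly_ring_mult poly_ring_const)
  finally have "- p \<in> poly_ring" .
  then show "mat2 1 p 0 1 $ i $ j \<in> poly_ring" "mat2 1 (- p) 0 1 $ i $ j \<in> poly_ring" for i j
    using assms by (simp_all add: mat2_poly)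
qed (simp_all add: mat2_mult mat_1_mat2)

lemma swap_GL2_poly: "mat2 0 1 1 0 \<in> GL2_poly"
  by (rule GL2_polyI[where h = "mat2 0 1 1 0"]) (simp_all add: mat2_poly mat2_mult mat_1_mat2)

lemma one_GL2_poly: "mat 1 \<in> GL2_poly"
  unfolding mat_1_mat2 by (rule unipotent_GL2_poly) simp

definition in_ray_orbit :: "'a::field vertex \<Rightarrow> nat \<Rightarrow> bool" where
  "in_ray_orbit x n \<longleftrightarrow> (\<exists>g\<in>GL2_poly. x = vertex_of (g ** ray_matrix n))"

lemma ray_vertex_eq: "ray_vertex n = vertex_of (ray_matrix n)"
  unfolding ray_vertex_def act_homothety_class vertex_of_def ray_matrix_def mat2_def ..

lemma in_ray_orbit_act: "in_ray_orbit x n \<longleftrightarrow> (\<exists>g\<in>GL2_poly. x = act g (ray_vertex n))"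
  by (simp add: in_ray_orbit_def ray_vertex_eq act_vertex_of)

text \<open>An element \<open>g\<close> of the modular group and a scalar \<open>c\<close> with \<open>g L\<^sub>n = c L\<^sub>m\<close>, where
  \<open>L\<^sub>n = t\<^sup>n \<O> \<oplus> \<O>\<close>, force \<open>n \<le> m\<close>.  A nonzero polynomial has nonnegative degree in \<open>t\<close>.  The first
  column of \<open>g\<close> is not zero, so \<open>deg c \<ge> n - m\<close> if \<open>n > m\<close>; the last row of the inverse of
  \<open>g\<close> is not zero, so \<open>deg c \<le> 0\<close>.\<close>

lemma ray_orbit_le:
  fixes g :: "'a::field fls ^ 2 ^ 2"
  assumes g: "g \<in> GL2_poly" and eq: "vertex_of (g ** ray_matrix n) = vertex_of (ray_matrix m)"
  shows "n \<le> m"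
proof (rule ccontr)
  assume "\<not> n \<le> m"
  then have nm: "m < n" by simp
  obtain h where h: "h \<in> GL2_poly" "g ** h = mat 1" "h ** g = mat 1" using g by (rule GL2_polyE)
  obtain c where c: "c \<noteq> 0"
    "(*v) (g ** ray_matrix n) ` std_lattice = (*s) c ` (*v) (ray_matrix m) ` std_lattice"
    using eq unfolding vertex_of_eq_iff by blast
  have pulled_back: "(*v) (ray_matrix n) ` std_lattice = (*s) c ` (*v) h ` (*v) (ray_matrix m) ` std_lattice"
  proof -
    have "(*v) h ` (*v) (g ** ray_matrix n) ` std_lattice = (*v) (ray_matrix n) ` std_lattice"
      using h(3) by (simp add: matrix_matrix_image matrix_mul_assoc)
    then show ?thesis by (simp add: c(2) scale_matrix_image)
  qed
  (* the first column of g sees the image of e1, the last row of its inverse h the images of e1 and e2 *)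
  define e1 e2 :: "'a fls ^ 2" where "e1 = vector [1, 0]" and "e2 = vector [0, 1]"
  have e: "e1 \<in> std_lattice" "e2 \<in> std_lattice" by (simp_all add: e1_def e2_def std_lattice_iff)
  have ray: "ray_matrix k *v v = vector [fls_X_inv ^ k * v $ 1, v $ 2]" for k and v :: "'a fls ^ 2"
    by (simp add: ray_matrix_def vec2_eq_iff)
  have gv: "(a *v v) $ i = a $ i $ 1 * v $ 1 + a $ i $ 2 * v $ 2" for a :: "'a fls ^ 2 ^ 2" and v i
    by (simp add: matrix_vector_mult_def sum_2)
  have "(g ** ray_matrix n) *v e1 \<in> (*s) c ` (*v) (ray_matrix m) ` std_lattice"
    unfolding c(2)[symmetric] using e(1) by (rule imageI)
  then obtain u where u: "u \<in> std_lattice" "g *v (ray_matrix n *v e1) = c *s (ray_matrix m *v u)"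
    by (auto simp: matrix_vector_mul_assoc)
  have u1: "g $ 1 $ 1 * fls_X_inv ^ n = c * (fls_X_inv ^ m * u $ 1)"
    "g $ 2 $ 1 * fls_X_inv ^ n = c * u $ 2"
    using arg_cong[OF u(2), of "\<lambda>v. v $ 1"] arg_cong[OF u(2), of "\<lambda>v. v $ 2"]
    by (simp_all add: ray gv e1_def)
  have "(h ** g) $ 1 $ 1 = 1" using h(3) by (simp add: mat_def)
  then have "g $ 1 $ 1 \<noteq> 0 \<or> g $ 2 $ 1 \<noteq> 0" by (auto simp: matrix_matrix_mult_def sum_2)
  then have "fls_subdegree c < 0"
  proof
    assume *: "g $ 1 $ 1 \<noteq> 0"
    then have "u $ 1 \<noteq> 0" using u1(1) by auto
    then have "fls_subdegree (g $ 1 $ 1) - int n = fls_subdegree c - int m + fls_subdegree (u $ 1)"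
      using arg_cong[OF u1(1), of fls_subdegree] c(1) * by simp
    moreover have "fls_subdegree (g $ 1 $ 1) \<le> 0" "fls_subdegree (u $ 1) \<ge> 0"
      using poly_ring_subdegree GL2_poly_entries[OF g] u(1) by (auto simp: std_lattice_iff int_ring_iff)
    ultimately show ?thesis using nm by linarith
  next
    assume *: "g $ 2 $ 1 \<noteq> 0"
    then have "u $ 2 \<noteq> 0" using u1(2) by auto
    then have "fls_subdegree (g $ 2 $ 1) - int n = fls_subdegree c + fls_subdegree (u $ 2)"
      using arg_cong[OF u1(2), of fls_subdegree] c(1) * by simp
    moreover have "fls_subdegree (g $ 2 $ 1) \<le> 0" "fls_subdegree (u $ 2) \<ge> 0"
      using poly_ring_subdegree GL2_poly_entries[OF g] u(1) by (auto simp: std_lattice_iff int_ring_iff)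
    ultimately show ?thesis using nm by linarith
  qed
  moreover have "fls_subdegree c \<ge> 0"
  proof -
    have second: "(c *s (h *v (ray_matrix m *v e))) $ 2 \<in> int_ring" if "e \<in> std_lattice" for e
    proof -
      have "c *s (h *v (ray_matrix m *v e)) \<in> (*v) (ray_matrix n) ` std_lattice"
        unfolding pulled_back using that by blast
      then obtain v where "v \<in> std_lattice" "c *s (h *v (ray_matrix m *v e)) = ray_matrix n *v v"
        by blast
      then show ?thesis by (simp only: ray std_lattice_iff vector_2)
    qed
    have w: "c * (h $ 2 $ 1 * fls_X_inv ^ m) \<in> int_ring" "c * h $ 2 $ 2 \<in> int_ring"
      using second[OF e(1)] second[OF e(2)] by (simp_all add: ray gv e1_def e2_def)
    have "(h ** g) $ 2 $ 2 = 1" using h(3) by (simp add: mat_def)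
    then have "h $ 2 $ 1 \<noteq> 0 \<or> h $ 2 $ 2 \<noteq> 0" by (auto simp: matrix_matrix_mult_def sum_2)
    moreover have "fls_subdegree (h $ 2 $ j) \<le> 0" for j
      using poly_ring_subdegree GL2_poly_entries[OF h(1)] by blast
    from this[of 1] this[of 2] have "h $ 2 $ 1 \<noteq> 0 \<Longrightarrow> fls_subdegree c \<ge> 0"
      "h $ 2 $ 2 \<noteq> 0 \<Longrightarrow> fls_subdegree c \<ge> 0"
      using w c(1) by (simp_all add: int_ring_iff)
    ultimately show ?thesis by blast
  qed
  ultimately show False by simp
qed

lemma in_ray_orbit_unique:
  assumes "in_ray_orbit x n" "in_ray_orbit x m" shows "n = m"
proof -
  have "k \<le> l" if kl: "in_ray_orbit x k" "in_ray_orbit x l" for k l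
  proof -
    obtain g where g1: "g \<in> GL2_poly" "x = vertex_of (g ** ray_matrix k)"
      using kl(1) unfolding in_ray_orbit_def by blast
    obtain g' where g2: "g' \<in> GL2_poly" "x = vertex_of (g' ** ray_matrix l)"
      using kl(2) unfolding in_ray_orbit_def by blast
    obtain h where h: "h \<in> GL2_poly" "h ** g' = mat 1" using GL2_polyE[OF g2(1)] by metis
    have "vertex_of (h ** g ** ray_matrix k) = vertex_of (h ** g' ** ray_matrix l)"
      using g1(2) g2(2) by (metis act_vertex_of matrix_mul_assoc)
    then have "vertex_of (h ** g ** ray_matrix k) = vertex_of (ray_matrix l)" by (simp add: h(2))
    with GL2_poly_mult[OF h(1) g1(1)] show "k \<le> l" by (rule ray_orbit_le)
  qed
  then show ?thesis using assms by (intro antisym) blast+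
qed

lemma height_eq: "in_ray_orbit x n \<Longrightarrow> height x = n"
  unfolding height_def in_ray_orbit_act[symmetric] using in_ray_orbit_unique by blast

lemma in_ray_orbit_left: "g \<in> GL2_poly \<Longrightarrow> in_ray_orbit (vertex_of h) n \<Longrightarrow> in_ray_orbit (vertex_of (g ** h)) n"
  unfolding in_ray_orbit_def by (metis GL2_poly_mult act_vertex_of matrix_mul_assoc)

lemma in_ray_orbit_ray_matrix: "in_ray_orbit (vertex_of (ray_matrix n)) n"
  unfolding in_ray_orbit_def using one_GL2_poly by (intro bexI[of _ "mat 1"]) simp_all

text \<open>The neighbours of \<open>v\<^sub>n\<close>: the upward one is \<open>v\<^sub>n\<^sub>+\<^sub>1\<close>, and the others are translates of
  \<open>v\<^sub>n\<^sub>-\<^sub>1\<close> by polynomial unipotent matrices.  For \<open>n = 0\<close> the lattice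
  \<open>t\<^sup>-\<^sup>1 \<O> \<oplus> \<O>\<close> takes the role of \<open>v\<^sub>n\<^sub>-\<^sub>1\<close>, and exchanging the coordinates turns it into \<open>v\<^sub>1\<close>.\<close>

lemma in_ray_orbit_up:
  "g \<in> GL2_poly \<Longrightarrow> in_ray_orbit (vertex_of (g ** ray_matrix n ** up_step)) (Suc n)"
  using in_ray_orbit_left[OF _ in_ray_orbit_ray_matrix[of "Suc n"]]
  by (simp add: ray_matrix_Suc flip: matrix_mul_assoc)

lemma in_ray_orbit_down:
  assumes "g \<in> GL2_poly"
  shows "in_ray_orbit (vertex_of (g ** ray_matrix (Suc n) ** down_step b)) n"
proof -
  have "ray_matrix (Suc n) ** down_step b = mat2 1 (fls_X_inv ^ Suc n * fls_const b) 0 1 ** ray_matrix n"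
    by (simp add: ray_matrix_def down_step_def mat2_mult mult.commute mult.left_commute)
  moreover have "mat2 1 (fls_X_inv ^ Suc n * fls_const b) 0 1 \<in> GL2_poly"
    by (intro unipotent_GL2_poly poly_ring_mult poly_ring_power poly_ring_t poly_ring_const)
  ultimately show ?thesis
    using in_ray_orbit_left[OF assms in_ray_orbit_left[OF _ in_ray_orbit_ray_matrix[of n]]]
    by (simp flip: matrix_mul_assoc)
qed

lemma in_ray_orbit_down_0:
  assumes "g \<in> GL2_poly"
  shows "in_ray_orbit (vertex_of (g ** ray_matrix 0 ** down_step b)) 1"
proof -
  let ?S = "mat2 0 1 1 0 :: 'a fls ^ 2 ^ 2"
  have "vertex_of (mat2 fls_X 0 0 1) = vertex_of (mat2 fls_X_inv 0 0 fls_X_inv ** mat2 fls_X 0 0 (1::'a fls))"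
    by (rule vertex_of_scale[symmetric]) simp
  also have "\<dots> = vertex_of (?S ** ray_matrix 1 ** ?S)"
    by (simp add: mat2_mult ray_matrix_def)
  also have "\<dots> = vertex_of (?S ** ray_matrix 1)"
    by (rule vertex_of_right_unit[where k' = ?S]) (simp_all add: mat2_integral mat2_mult mat_1_mat2)
  finally have "in_ray_orbit (vertex_of (mat2 fls_X 0 0 (1::'a fls))) 1"
    using in_ray_orbit_left[OF swap_GL2_poly in_ray_orbit_ray_matrix[of 1]] by simp
  moreover have "ray_matrix 0 ** down_step b = mat2 1 (fls_const b) 0 1 ** mat2 fls_X 0 0 1"
    by (simp add: ray_matrix_def down_step_def mat2_mult)
  moreover have "mat2 1 (fls_const b) 0 1 \<in> GL2_poly" by (simp add: unipotent_GL2_poly)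
  ultimately show ?thesis
    using in_ray_orbit_left[OF assms in_ray_orbit_left] by (simp flip: matrix_mul_assoc)
qed

lemma invertible_ray_matrix [simp]: "invertible (ray_matrix n)"
  using upper_triangular_ray_matrix unfolding upper_triangular_def by blast

lemma in_ray_orbit_adjacent:
  assumes "in_ray_orbit x n" "adjacent x y" shows "\<exists>k. in_ray_orbit y k"
proof -
  obtain g where g: "g \<in> GL2_poly" "x = vertex_of (g ** ray_matrix n)"
    using assms(1) unfolding in_ray_orbit_def by blast
  have "invertible (g ** ray_matrix n)" using g(1) by (simp add: GL2_poly_invertible invertible_mult)
  from assms(2)[unfolded g(2) adjacent_iff_step[OF this]] show ?thesis
    using in_ray_orbit_up[OF g(1)] in_ray_orbit_down[OF g(1)] in_ray_orbit_down_0[OF g(1)]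
    by (cases n) blast+
qed

text \<open>Every vertex has a height, because far enough up its ancestors lie on the ray of the \<open>v\<^sub>n\<close>, and
  the union of the orbits is closed under passing to neighbours.\<close>

lemma in_ray_orbit_ancestor:
  assumes "upper_triangular h"
  shows "\<exists>m n. in_ray_orbit (vertex_of (h ** ray_matrix m)) n"
proof -
  define a b d where "a = h $ 1 $ 1" and "b = h $ 1 $ 2" and "d = h $ 2 $ 2"
  have ad: "a \<noteq> 0" "d \<noteq> 0" using upper_triangular_diagonal[OF assms] by (simp_all add: a_def d_def)
  have h: "h = mat2 a b 0 d"
    using assms mat2_eta[of h] by (simp add: upper_triangular_def a_def b_def d_def)
  (* m is so large that b / (a t^m) is integral and a t^m / d has nonnegative degree in t *)
  define m where "m = nat (\<bar>fls_subdegree a\<bar> + \<bar>fls_subdegree b\<bar> + \<bar>fls_subdegree d\<bar>)"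
  define A where "A = a * fls_X_inv ^ m"
  have A: "A \<noteq> 0" "fls_subdegree A = fls_subdegree a - int m" using ad by (simp_all add: A_def)
  have "b / A \<in> int_ring"
    using A by (cases "b = 0") (auto simp: int_ring_iff fls_divide_subdegree m_def)
  define u where "u = A / d"
  define n where "n = nat (- fls_subdegree u)"
  have "fls_subdegree u = fls_subdegree A - fls_subdegree d"
    using A ad by (simp add: u_def fls_divide_subdegree)
  also have "\<dots> \<le> 0" using A(2) by (simp add: m_def)
  finally have u: "u \<noteq> 0" "fls_subdegree u = - int n" using A(1) ad by (simp_all add: u_def n_def)
  define w where "w = u * fls_X ^ n"
  have w: "w \<noteq> 0" "fls_subdegree w = 0" using u by (simp_all add: w_def)
  then have wi: "w \<in> int_ring" "1 / w \<in> int_ring"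
    by (simp_all add: int_ring_iff fls_divide_subdegree)
  have "fls_X_inv ^ n * fls_X ^ n = (1 :: 'a fls)" by (simp flip: power_mult_distrib)
  then have uw: "fls_X_inv ^ n * w = u" by (simp add: w_def algebra_simps)
  have "h ** ray_matrix m = mat2 A 0 0 d ** mat2 1 (b / A) 0 1"
    using A(1) by (simp add: h ray_matrix_def mat2_mult A_def)
  also have "vertex_of \<dots> = vertex_of (mat2 A 0 0 d)"
    using \<open>b / A \<in> int_ring\<close>
    by (intro vertex_of_right_unit[where k' = "mat2 1 (- (b / A)) 0 1"])
       (simp_all add: mat2_integral mat2_mult mat_1_mat2)
  also have "\<dots> = vertex_of (mat2 (1 / d) 0 0 (1 / d) ** mat2 A 0 0 d)"
    using ad by (intro vertex_of_scale[symmetric]) simp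
  also have "mat2 (1 / d) 0 0 (1 / d) ** mat2 A 0 0 d = ray_matrix n ** mat2 w 0 0 1"
    using ad by (simp add: mat2_mult ray_matrix_def uw) (simp add: u_def)
  also have "vertex_of \<dots> = vertex_of (ray_matrix n)"
    using w wi by (intro vertex_of_right_unit[where k' = "mat2 (1 / w) 0 0 1"])
       (simp_all add: mat2_integral mat2_mult mat_1_mat2)
  finally show ?thesis using in_ray_orbit_ray_matrix by metis
qed

lemma vertices_in_ray_orbit:
  assumes "x \<in> vertices" shows "in_ray_orbit x (height x)"
proof -
  obtain h where h: "upper_triangular h" "x = vertex_of h"
    using vertex_of_upper_triangular[OF assms] by metis
  obtain m k where "in_ray_orbit (vertex_of (h ** ray_matrix m)) k"
    using in_ray_orbit_ancestor[OF h(1)] by blast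
  then have "\<exists>k. in_ray_orbit (vertex_of (h ** ray_matrix 0)) k"
  proof (induction m arbitrary: k)
    case (Suc m)
    have "h ** ray_matrix (Suc m) ** down_step 0 = h ** ray_matrix m"
      unfolding ray_matrix_Suc[symmetric] matrix_mul_assoc[symmetric] by (simp add: up_down_step)
    moreover have "invertible (h ** ray_matrix (Suc m))"
      using h(1) by (simp add: upper_triangular_def invertible_mult)
    ultimately have "adjacent (vertex_of (h ** ray_matrix (Suc m))) (vertex_of (h ** ray_matrix m))"
      by (metis adjacent_iff_step)
    from in_ray_orbit_adjacent[OF Suc.prems this] Suc.IH show ?case by blast
  qed blast
  moreover have "ray_matrix 0 = (mat 1 :: 'a fls ^ 2 ^ 2)" by (simp add: ray_matrix_def mat_1_mat2)
  ultimately obtain k where "in_ray_orbit x k" by (auto simp: h(2))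
  then show ?thesis using height_eq by metis
qed

lemma adjacent_vertex_of_set:
  assumes "invertible g"
  shows "{y. adjacent (vertex_of g) y} =
    insert (vertex_of (g ** up_step)) (range (\<lambda>b. vertex_of (g ** down_step b)))"
  using adjacent_iff_step[OF assms] by blast

lemma card_neighbours:
  fixes x :: "'a::{field,finite} vertex"
  assumes "x \<in> vertices"
  shows "finite {y. adjacent x y}" "card {y. adjacent x y} = Suc CARD('a)"
proof -
  obtain g where g: "invertible g" "x = vertex_of g" using assms vertices_eq[of x] by blast
  have "inj (\<lambda>b. vertex_of (g ** down_step b))"
    by (intro injI) (simp add: vertex_of_left_cancel[OF g(1)] vertex_of_steps_distinct(1))
  then have "card (range (\<lambda>b. vertex_of (g ** down_step b))) = CARD('a)" by (rule card_image)
  moreover have "vertex_of (g ** up_step) \<notin> range (\<lambda>b. vertex_of (g ** down_step b))"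
    by (auto simp: vertex_of_left_cancel[OF g(1)] vertex_of_steps_distinct(2)[THEN not_sym])
  ultimately show "finite {y. adjacent x y}" "card {y. adjacent x y} = Suc CARD('a)"
    unfolding g(2) adjacent_vertex_of_set[OF g(1)] by simp_all
qed

lemma neighbour_height_0:
  assumes "adjacent x y" "height x = 0" shows "height y = 1"
proof -
  obtain g where g: "g \<in> GL2_poly" "x = vertex_of (g ** ray_matrix 0)"
    using vertices_in_ray_orbit[OF adjacent_vertices(1)[OF assms(1)]] assms(2)
    unfolding in_ray_orbit_def by auto
  have "invertible (g ** ray_matrix 0)" using g(1) by (simp add: GL2_poly_invertible invertible_mult)
  from assms(1)[unfolded g(2) adjacent_iff_step[OF this]] show ?thesis
    using height_eq[OF in_ray_orbit_up[OF g(1)]] height_eq[OF in_ray_orbit_down_0[OF g(1)]] by auto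
qed

lemma neighbour_height_Suc:
  assumes "x \<in> vertices" "height x = Suc k"
  obtains u where "adjacent x u" "height u = Suc (Suc k)"
    "\<forall>y. adjacent x y \<longrightarrow> y \<noteq> u \<longrightarrow> height y = k"
proof -
  obtain g where g: "g \<in> GL2_poly" "x = vertex_of (g ** ray_matrix (Suc k))"
    using vertices_in_ray_orbit[OF assms(1)] assms(2) unfolding in_ray_orbit_def by auto
  have inv: "invertible (g ** ray_matrix (Suc k))" using g(1) by (simp add: GL2_poly_invertible invertible_mult)
  show ?thesis
  proof (rule that)
    let ?u = "vertex_of (g ** ray_matrix (Suc k) ** up_step)"
    show "adjacent x ?u" unfolding g(2) adjacent_iff_step[OF inv] by blast
    show "height ?u = Suc (Suc k)" by (rule height_eq[OF in_ray_orbit_up[OF g(1)]])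
    show "\<forall>y. adjacent x y \<longrightarrow> y \<noteq> ?u \<longrightarrow> height y = k"
      using height_eq[OF in_ray_orbit_down[OF g(1)]] unfolding g(2) adjacent_iff_step[OF inv] by blast
  qed
qed

section \<open>The Markov chain of states\<close>

text \<open>The mean of \<open>\<Phi>\<close> over the shadow of depth \<open>N\<close> of an edge in state \<open>(bwd, k)\<close> or \<open>(fwd, k)\<close>,
  by recursion on the first step.  A backward edge comes from the unique higher neighbour, so all
  \<open>q\<close> continuations descend, until height \<open>0\<close> turns them around.  A forward edge comes from one
  of the lower neighbours, so one continuation rises and the other \<open>q - 1\<close> fall back.\<close>

fun bwd_mean fwd_mean :: "nat \<Rightarrow> (nat \<Rightarrow> complex) \<Rightarrow> nat \<Rightarrow> nat \<Rightarrow> complex" where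
  "bwd_mean q \<Phi> k 0 = \<Phi> k"
| "bwd_mean q \<Phi> 0 (Suc N) = fwd_mean q \<Phi> 1 N"
| "bwd_mean q \<Phi> (Suc k) (Suc N) = bwd_mean q \<Phi> k N"
| "fwd_mean q \<Phi> k 0 = \<Phi> k"
| "fwd_mean q \<Phi> k (Suc N) =
    (fwd_mean q \<Phi> (Suc k) N + (of_nat q - 1) * bwd_mean q \<Phi> (k - 1) N) / of_nat q"

lemma Desc_sum:
  fixes x y :: "'a::{field,finite} vertex"
  shows "((x, y) \<in> bwd_edges k \<longrightarrow> finite (Desc N (x, y)) \<and>
      (\<Sum>v\<in>Desc N (x, y). \<Phi> (height v)) = of_nat CARD('a) ^ N * bwd_mean CARD('a) \<Phi> k N) \<and>
    ((x, y) \<in> fwd_edges k \<longrightarrow> finite (Desc N (x, y)) \<and>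
      (\<Sum>v\<in>Desc N (x, y). \<Phi> (height v)) = of_nat CARD('a) ^ N * fwd_mean CARD('a) \<Phi> k N)"
proof (induction N arbitrary: x y k)
  case 0
  then show ?case by (auto simp: bwd_edges_def fwd_edges_def Desc_0)
next
  case (Suc N)
  let ?q = "CARD('a)"
  define W where "W = {w. adjacent y w} - {x}"
  have q: "?q > 0" by simp
  have step: "finite W" "card W = ?q"
    "(\<forall>w\<in>W. finite (Desc N (y, w))) \<Longrightarrow> finite (Desc (Suc N) (x, y)) \<and>
      (\<Sum>v\<in>Desc (Suc N) (x, y). \<Phi> (height v)) = (\<Sum>w\<in>W. \<Sum>v\<in>Desc N (y, w). \<Phi> (height v))"
    if "adjacent x y"
  proof -
    have y: "y \<in> vertices" "adjacent y x" using that adjacent_vertices adjacent_sym by blast+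
    show W: "finite W" using card_neighbours(1)[OF y(1)] by (simp add: W_def)
    show "card W = ?q" using card_neighbours[OF y(1)] y(2) by (simp add: W_def)
    show "finite (Desc (Suc N) (x, y)) \<and>
      (\<Sum>v\<in>Desc (Suc N) (x, y). \<Phi> (height v)) = (\<Sum>w\<in>W. \<Sum>v\<in>Desc N (y, w). \<Phi> (height v))"
      if "\<forall>w\<in>W. finite (Desc N (y, w))"
      unfolding Desc_Suc[OF \<open>adjacent x y\<close>] W_def[symmetric]
      using W that Desc_disjoint by (intro conjI finite_UN_I sum.UNION_disjoint) blast+
  qed
  have bwd: "finite (Desc (Suc N) (x, y)) \<and>
      (\<Sum>v\<in>Desc (Suc N) (x, y). \<Phi> (height v)) = of_nat ?q ^ Suc N * bwd_mean ?q \<Phi> k (Suc N)"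
    if e: "(x, y) \<in> bwd_edges k"
  proof -
    have xy: "adjacent x y" "height y = k" "height x = Suc k" using e by (simp_all add: bwd_edges_def)
    have "\<exists>c. (\<forall>w\<in>W. finite (Desc N (y, w)) \<and>
        (\<Sum>v\<in>Desc N (y, w). \<Phi> (height v)) = of_nat ?q ^ N * c) \<and> bwd_mean ?q \<Phi> k (Suc N) = c"
    proof (cases k)
      case 0
      have "(y, w) \<in> fwd_edges 1" if "w \<in> W" for w
        using that xy 0 neighbour_height_0[of y w] by (simp add: W_def fwd_edges_def)
      then show ?thesis using Suc.IH 0 by auto
    next
      case (Suc l)
      obtain u where u: "\<forall>z. adjacent y z \<longrightarrow> z \<noteq> u \<longrightarrow> height z = l"
        using neighbour_height_Suc[OF adjacent_vertices(2)[OF xy(1)], of l] xy(2) Suc by metis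
      have "u = x" using u adjacent_sym[OF xy(1)] xy(3) Suc by auto
      then have "(y, w) \<in> bwd_edges l" if "w \<in> W" for w
        using that xy Suc u by (simp add: W_def bwd_edges_def)
      then show ?thesis using Suc.IH Suc by auto
    qed
    then show ?thesis using step[OF xy(1)] by auto
  qed
  have fwd: "finite (Desc (Suc N) (x, y)) \<and>
      (\<Sum>v\<in>Desc (Suc N) (x, y). \<Phi> (height v)) = of_nat ?q ^ Suc N * fwd_mean ?q \<Phi> k (Suc N)"
    if e: "(x, y) \<in> fwd_edges k"
  proof -
    have xy: "adjacent x y" "height y = k" "Suc (height x) = k" using e by (simp_all add: fwd_edges_def)
    define l where "l = height x"
    have l: "k = Suc l" "height x = l" using xy(3) by (simp_all add: l_def)
    have "height y = Suc l" using xy l by simp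
    then obtain u where u: "adjacent y u" "height u = Suc (Suc l)"
        "\<forall>z. adjacent y z \<longrightarrow> z \<noteq> u \<longrightarrow> height z = l"
      by (rule neighbour_height_Suc[OF adjacent_vertices(2)[OF xy(1)]])
    have uW: "u \<in> W" using u(1,2) l(2) by (auto simp: W_def)
    have Du: "finite (Desc N (y, u))"
      "(\<Sum>v\<in>Desc N (y, u). \<Phi> (height v)) = of_nat ?q ^ N * fwd_mean ?q \<Phi> (Suc k) N"
      using Suc.IH[of y u "Suc k"] u(1,2) xy(2) l(1) by (simp_all add: fwd_edges_def)
    have Dw: "finite (Desc N (y, w))"
      "(\<Sum>v\<in>Desc N (y, w). \<Phi> (height v)) = of_nat ?q ^ N * bwd_mean ?q \<Phi> l N"
      if "w \<in> W - {u}" for w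
    proof -
      have "height w = l" "adjacent y w" using u(3) that by (auto simp: W_def)
      then show "finite (Desc N (y, w))"
        "(\<Sum>v\<in>Desc N (y, w). \<Phi> (height v)) = of_nat ?q ^ N * bwd_mean ?q \<Phi> l N"
        using Suc.IH[of y w l] xy(2) l(1) by (simp_all add: bwd_edges_def)
    qed
    have "\<forall>w\<in>W. finite (Desc N (y, w))" using Du(1) Dw(1) by blast
    note D = step(3)[OF xy(1) this]
    have "(\<Sum>w\<in>W - {u}. \<Sum>v\<in>Desc N (y, w). \<Phi> (height v)) =
        (\<Sum>w\<in>W - {u}. of_nat ?q ^ N * bwd_mean ?q \<Phi> l N)"
      using Dw(2) by (rule sum.cong[OF refl])
    also have "\<dots> = of_nat (?q - 1) * (of_nat ?q ^ N * bwd_mean ?q \<Phi> l N)"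
      using step(1,2)[OF xy(1)] uW by simp
    finally have "(\<Sum>w\<in>W. \<Sum>v\<in>Desc N (y, w). \<Phi> (height v)) =
        of_nat ?q ^ N * fwd_mean ?q \<Phi> (Suc k) N + of_nat (?q - 1) * (of_nat ?q ^ N * bwd_mean ?q \<Phi> l N)"
      using sum.remove[OF step(1)[OF xy(1)] uW, of "\<lambda>w. \<Sum>v\<in>Desc N (y, w). \<Phi> (height v)"] Du(2)
      by (simp only:)
    also have "\<dots> = of_nat ?q ^ Suc N * fwd_mean ?q \<Phi> k (Suc N)"
      using q l(1) by (simp add: of_nat_diff field_simps)
    finally show ?thesis using D by simp
  qed
  show ?case using bwd fwd by blast
qed

lemma integral_ev_measure_finite_support:
  fixes \<Phi> :: "nat \<Rightarrow> complex"
  assumes "finite S" "\<And>j. p j \<ge> 0" "\<And>j. j \<notin> S \<Longrightarrow> p j = 0"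
  shows "(\<integral>j. \<Phi> j \<partial>ev_measure p) = (\<Sum>j\<in>S. of_real (p j) * (if even j then \<Phi> j else 0))"
proof -
  let ?E = "{j::nat. even j}"
  have supp: "{j\<in>?E. p j *\<^sub>R \<Phi> j \<noteq> 0} \<subseteq> S" using assms(3) by auto
  have "(\<integral>j. \<Phi> j \<partial>ev_measure p) = (\<integral>j. p j *\<^sub>R \<Phi> j \<partial>count_space ?E)"
    unfolding ev_measure_def point_measure_def using assms(2) by (intro integral_density) auto
  also have "\<dots> = (\<Sum>j | j \<in> ?E \<and> p j *\<^sub>R \<Phi> j \<noteq> 0. p j *\<^sub>R \<Phi> j)"
    using finite_subset[OF supp assms(1)] by (intro lebesgue_integral_count_space_finite_support) auto
  also have "\<dots> = (\<Sum>j\<in>S. of_real (p j) * (if even j then \<Phi> j else 0))"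
    using assms(1) supp by (intro sum.mono_neutral_cong_left) (auto simp: scaleR_conv_of_real)
  finally show ?thesis .
qed

text \<open>Two uses are made of the fact that the means over a shadow are the same for all edges of \<open>E\<close>.
  Applied to indicator functions it shows that the law is the same for all edges, so that
  \<open>the_elem\<close> selects it; applied to \<open>\<Phi>\<close> it computes the integral.  The cut-off of \<open>\<Phi>\<close> at
  odd heights is there because \<open>ev_measure\<close> lives on the even numbers.\<close>

lemma integral_the_elem_shadow_law:
  fixes E :: "('a::{field,finite} vertex \<times> 'a vertex) set"
    and \<Phi> :: "nat \<Rightarrow> complex" and m :: "(nat \<Rightarrow> complex) \<Rightarrow> complex"
  assumes "E \<noteq> {}"
    and E: "\<And>e \<Psi>. e \<in> E \<Longrightarrow>
      finite (Desc N e) \<and> (\<Sum>v\<in>Desc N e. \<Psi> (height v)) = of_nat CARD('a) ^ N * m \<Psi>"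
  shows "(\<integral>j. \<Phi> j \<partial>ev_measure (\<lambda>j. the_elem ((\<lambda>e. shadow_law e N j) ` E))) =
    m (\<lambda>j. if even j then \<Phi> j else 0)"
proof -
  let ?q = "CARD('a)" and ?\<Psi> = "\<lambda>j. if even j then \<Phi> j else 0"
  obtain e where e: "e \<in> E" using assms(1) by blast
  have q: "?q > 0" by simp
  have law: "of_real (shadow_law e' N j) = m (\<lambda>i. if i = j then 1 else 0)" if "e' \<in> E" for e' j
  proof -
    have fin: "finite (Desc N e')" using E[OF that] by blast
    have "of_nat (card {v \<in> Desc N e'. height v = j}) =
        (\<Sum>v\<in>Desc N e'. if height v = j then 1 else 0 :: complex)"
      using fin by (simp add: sum.If_cases Int_def)
    also have "\<dots> = of_nat ?q ^ N * m (\<lambda>i. if i = j then 1 else 0)"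
      using E[OF that, of "\<lambda>i. if i = j then 1 else 0"] by simp
    finally show ?thesis using q by (simp add: shadow_law_def)
  qed
  have const: "the_elem ((\<lambda>e. shadow_law e N j) ` E) = shadow_law e N j" for j
  proof -
    have "shadow_law e' N j = shadow_law e N j" if "e' \<in> E" for e'
    proof -
      have "complex_of_real (shadow_law e' N j) = of_real (shadow_law e N j)"
        by (simp only: law[OF that] law[OF e])
      then show ?thesis by (simp only: of_real_eq_iff)
    qed
    then have "(\<lambda>e. shadow_law e N j) ` E = (\<lambda>_. shadow_law e N j) ` E" by (rule image_cong[OF refl])
    then show ?thesis by (simp only: image_constant[OF e] the_elem_eq)
  qed
  let ?D = "Desc N e"
  have fin: "finite ?D" using E[OF e] by blast
  have "(\<integral>j. \<Phi> j \<partial>ev_measure (shadow_law e N)) =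
      (\<Sum>j\<in>height ` ?D. of_real (shadow_law e N j) * ?\<Psi> j)"
  proof (rule integral_ev_measure_finite_support)
    show "shadow_law e N j = 0" if "j \<notin> height ` ?D" for j
    proof -
      have "{v \<in> ?D. height v = j} = {}" using that by auto
      then show ?thesis by (simp only: shadow_law_def card.empty)
    qed
  qed (use fin in \<open>simp_all add: shadow_law_def\<close>)
  also have "\<dots> = (\<Sum>j\<in>height ` ?D. \<Sum>v | v \<in> ?D \<and> height v = j. ?\<Psi> (height v)) / of_nat ?q ^ N"
    unfolding sum_divide_distrib by (intro sum.cong) (simp_all add: shadow_law_def)
  also have "\<dots> = (\<Sum>v\<in>?D. ?\<Psi> (height v)) / of_nat ?q ^ N"
    using sum.image_gen[OF fin, of "\<lambda>v. ?\<Psi> (height v)" height] by simp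
  also have "\<dots> = m ?\<Psi>" using E[OF e, of ?\<Psi>] q by simp
  finally show ?thesis by (simp add: const)
qed

lemma adjacent_ray: "adjacent (vertex_of (ray_matrix n)) (vertex_of (ray_matrix (Suc n) :: 'a::field fls ^ 2 ^ 2))"
  unfolding adjacent_iff_step[OF invertible_ray_matrix] by (simp add: ray_matrix_Suc)

lemma edges_nonempty:
  "(bwd_edges k :: ('a::field vertex \<times> 'a vertex) set) \<noteq> {}"
  "(fwd_edges (Suc k) :: ('a::field vertex \<times> 'a vertex) set) \<noteq> {}"
proof -
  let ?v = "\<lambda>n. vertex_of (ray_matrix n :: 'a fls ^ 2 ^ 2)"
  have h: "height (?v n) = n" for n by (rule height_eq[OF in_ray_orbit_ray_matrix])
  have "(?v (Suc k), ?v k) \<in> bwd_edges k" "(?v k, ?v (Suc k)) \<in> fwd_edges (Suc k)"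
    using adjacent_ray[of k] adjacent_sym[OF adjacent_ray[of k]] by (simp_all add: bwd_edges_def fwd_edges_def h)
  then show "(bwd_edges k :: ('a vertex \<times> 'a vertex) set) \<noteq> {}"
    "(fwd_edges (Suc k) :: ('a vertex \<times> 'a vertex) set) \<noteq> {}" by blast+
qed

lemma integral_mu_bwd:
  fixes \<kappa> :: "'a::{field,finite} itself" and \<Phi> :: "nat \<Rightarrow> complex"
  shows "(\<integral>j. \<Phi> j \<partial>ev_measure (mu_bwd \<kappa> k N)) =
    bwd_mean CARD('a) (\<lambda>j. if even j then \<Phi> j else 0) k N"
  unfolding mu_bwd_def
proof (rule integral_the_elem_shadow_law[OF edges_nonempty(1), where m = "\<lambda>\<Psi>. bwd_mean CARD('a) \<Psi> k N"])
  fix e :: "'a vertex \<times> 'a vertex" and \<Psi> :: "nat \<Rightarrow> complex" assume "e \<in> bwd_edges k"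
  then show "finite (Desc N e) \<and> (\<Sum>v\<in>Desc N e. \<Psi> (height v)) = of_nat CARD('a) ^ N * bwd_mean CARD('a) \<Psi> k N"
    using Desc_sum[of "fst e" "snd e" k N \<Psi>] by simp
qed

lemma integral_mu_fwd:
  fixes \<kappa> :: "'a::{field,finite} itself" and \<Phi> :: "nat \<Rightarrow> complex"
  shows "(\<integral>j. \<Phi> j \<partial>ev_measure (mu_fwd \<kappa> (Suc k) N)) =
    fwd_mean CARD('a) (\<lambda>j. if even j then \<Phi> j else 0) (Suc k) N"
  unfolding mu_fwd_def
proof (rule integral_the_elem_shadow_law[OF edges_nonempty(2), where m = "\<lambda>\<Psi>. fwd_mean CARD('a) \<Psi> (Suc k) N"])
  fix e :: "'a vertex \<times> 'a vertex" and \<Psi> :: "nat \<Rightarrow> complex" assume "e \<in> fwd_edges (Suc k)"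
  then show "finite (Desc N e) \<and> (\<Sum>v\<in>Desc N e. \<Psi> (height v)) = of_nat CARD('a) ^ N * fwd_mean CARD('a) \<Psi> (Suc k) N"
    using Desc_sum[of "fst e" "snd e" "Suc k" N \<Psi>] by simp
qed

section \<open>Solving the recursion\<close>

lemma bwd_mean_shift: "k \<le> N \<Longrightarrow> bwd_mean q \<Phi> k N = bwd_mean q \<Phi> 0 (N - k)"
proof (induction k arbitrary: N)
  case (Suc k)
  then obtain n where "N = Suc n" by (cases N) auto
  then show ?case using Suc by simp
qed simp

text \<open>Raising the root and the depth by one changes the mean only through the two highest heights.
  This identity does the work of an explicit formula for the forward laws.  It holds because the
  backward means in the recursions of both sides agree, so that only the error terms remain.\<close>

lemma fwd_mean_diagonal:
  assumes "q > 0"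
  shows "fwd_mean q \<Phi> (Suc (Suc k)) (Suc N) =
    fwd_mean q \<Phi> (Suc k) N + (\<Phi> (k + N + 3) - \<Phi> (k + N + 1)) / of_nat q ^ Suc N"
proof (induction N arbitrary: k)
  case 0
  then show ?case using assms by (simp add: field_simps numeral_3_eq_3)
next
  case (Suc N)
  have "fwd_mean q \<Phi> (Suc (Suc k)) (Suc (Suc N)) =
      (fwd_mean q \<Phi> (Suc (Suc (Suc k))) (Suc N) + (of_nat q - 1) * bwd_mean q \<Phi> k N) / of_nat q"
    by simp
  also have "\<dots> = (fwd_mean q \<Phi> (Suc (Suc k)) N + (of_nat q - 1) * bwd_mean q \<Phi> k N) / of_nat q
      + (\<Phi> (k + Suc N + 3) - \<Phi> (k + Suc N + 1)) / of_nat q ^ Suc (Suc N)"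
    using assms by (subst Suc.IH) (simp add: field_simps)
  finally show ?case by simp
qed

text \<open>The summation index \<open>r\<close> is the number of upward steps before the path first turns back.\<close>

lemma fwd_mean_unroll:
  "fwd_mean q \<Phi> (Suc k) N = \<Phi> (Suc k + N) / of_nat q ^ N +
    (of_nat q - 1) * (\<Sum>r<N. bwd_mean q \<Phi> (k + r) (N - r - 1) / of_nat q ^ Suc r)"
proof (induction N arbitrary: k)
  case (Suc N)
  define T where "T = (\<Sum>r<N. bwd_mean q \<Phi> (Suc k + r) (N - r - 1) / of_nat q ^ Suc r)"
  have "(\<Sum>r<N. bwd_mean q \<Phi> (k + Suc r) (Suc N - Suc r - 1) / of_nat q ^ Suc (Suc r)) = T / of_nat q"
    unfolding T_def sum_divide_distrib by (intro sum.cong) (simp_all add: ac_simps)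
  then show ?case
    unfolding sum.lessThan_Suc_shift fwd_mean.simps(2) Suc.IH T_def[symmetric]
    by (simp only:) (simp add: add_divide_distrib distrib_left ac_simps)
qed simp

text \<open>The value \<open>bwd_chain q \<Phi> m\<close> is the mean of the backward shadow of depth \<open>k + 2 m\<close> over a root of height
  \<open>k\<close>, and \<open>damped q \<Phi> j\<close> is, for \<open>j \<ge> 1\<close>, \<open>\<rho>(2 j) \<Phi>(2 j)\<close> up to a constant factor.\<close>

definition bwd_chain :: "nat \<Rightarrow> (nat \<Rightarrow> complex) \<Rightarrow> nat \<Rightarrow> complex" where
  "bwd_chain q \<Phi> m = bwd_mean q \<Phi> 0 (2 * m)"

definition damped :: "nat \<Rightarrow> (nat \<Rightarrow> complex) \<Rightarrow> nat \<Rightarrow> complex" where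
  "damped q \<Phi> j = \<Phi> (2 * j) / of_nat q ^ (2 * j)"

lemma bwd_chain_Suc:
  assumes "q > 0"
  shows "bwd_chain q \<Phi> (Suc m) = bwd_chain q \<Phi> m + (\<Phi> (2 * m + 2) - \<Phi> (2 * m)) / of_nat q ^ (2 * m + 1)"
proof (cases m)
  case 0
  then show ?thesis using assms by (simp add: bwd_chain_def numeral_2_eq_2 field_simps)
next
  case (Suc n)
  let ?N = "2 * n + 1"
  have two: "bwd_chain q \<Phi> (Suc i) = fwd_mean q \<Phi> 1 (2 * i + 1)" for i by (simp add: bwd_chain_def)
  have "fwd_mean q \<Phi> 1 (Suc (Suc ?N)) =
      (fwd_mean q \<Phi> (Suc (Suc 0)) (Suc ?N) + (of_nat q - 1) * fwd_mean q \<Phi> 1 ?N) / of_nat q"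
    by simp
  also have "\<dots> = fwd_mean q \<Phi> 1 ?N + (\<Phi> (?N + 3) - \<Phi> (?N + 1)) / of_nat q ^ Suc (Suc ?N)"
    unfolding fwd_mean_diagonal[OF assms] using assms by (simp add: field_simps)
  finally show ?thesis unfolding two Suc by (simp add: two numeral_eq_Suc)
qed

lemma bwd_chain_Suc_damped:
  assumes "q > 0"
  shows "bwd_chain q \<Phi> (Suc m) = bwd_chain q \<Phi> m + of_nat q * damped q \<Phi> (Suc m) - damped q \<Phi> m / of_nat q"
  unfolding bwd_chain_Suc[OF assms] using assms by (simp add: damped_def field_simps)

lemma rho_ev_Suc: "rho_ev q (2 * Suc m) = ((real q)\<^sup>2 - 1) / real q ^ (2 * m + 3)"
proof -
  have "- int (2 * Suc m) - 1 = - int (2 * m + 3)" by simp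
  then have "real q powi (- int (2 * Suc m) - 1) = 1 / real q ^ (2 * m + 3)"
    by (simp only: power_int_minus power_int_of_nat inverse_eq_divide)
  then show ?thesis by (simp add: rho_ev_def)
qed

text \<open>Summation by parts in \<open>bwd_chain_Suc\<close>; the weights of \<open>\<rho>\<close> appear as
  \<open>(q\<^sup>2 - 1) q\<^sup>-\<^sup>2\<^sup>m\<^sup>-\<^sup>1 = q\<^sup>-\<^sup>2\<^sup>m\<^sup>+\<^sup>1 - q\<^sup>-\<^sup>2\<^sup>m\<^sup>-\<^sup>1\<close>.\<close>

lemma bwd_chain_closed_form:
  assumes "q > 0"
  shows "bwd_chain q \<Phi> m = (\<Sum>i\<le>m. of_real (rho_ev q (2 * i)) * \<Phi> (2 * i)) + damped q \<Phi> m / of_nat q"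
proof (induction m)
  case 0
  then show ?case using assms by (simp add: bwd_chain_def damped_def rho_ev_def field_simps)
next
  case (Suc m)
  have "of_real (rho_ev q (2 * Suc m)) * \<Phi> (2 * Suc m) =
      of_nat q * damped q \<Phi> (Suc m) - damped q \<Phi> (Suc m) / of_nat q"
    unfolding rho_ev_Suc damped_def using assms
    by (simp add: field_simps power2_eq_square power_add numeral_3_eq_3)
  then show ?case by (simp add: bwd_chain_Suc_damped[OF assms] Suc.IH)
qed

text \<open>The forward mean over a root of height \<open>k + 1\<close> whose depth exceeds the height by \<open>2 m\<close>; with
  this parametrization \<open>fwd_mean_diagonal\<close> relates neighbouring values of \<open>k\<close> at the same \<open>m\<close>.\<close>

definition fwd_chain :: "nat \<Rightarrow> (nat \<Rightarrow> complex) \<Rightarrow> nat \<Rightarrow> nat \<Rightarrow> complex" where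
  "fwd_chain q \<Phi> k m = fwd_mean q \<Phi> (Suc k) (2 * m + Suc k)"

lemma fwd_chain_0: "fwd_chain q \<Phi> 0 m = bwd_chain q \<Phi> (Suc m)"
  by (simp add: fwd_chain_def bwd_chain_def)

lemma fwd_chain_Suc:
  assumes "q > 0"
  shows "fwd_chain q \<Phi> (Suc k) m = fwd_chain q \<Phi> k m +
    of_nat q ^ (k + 2) * damped q \<Phi> (m + k + 2) - of_nat q ^ k * damped q \<Phi> (m + k + 1)"
proof -
  have "fwd_chain q \<Phi> (Suc k) m = fwd_mean q \<Phi> (Suc (Suc k)) (Suc (2 * m + Suc k))"
    by (simp add: fwd_chain_def)
  also have "\<dots> = fwd_chain q \<Phi> k m +
      (\<Phi> (2 * (m + k + 2)) - \<Phi> (2 * (m + k + 1))) / of_nat q ^ (2 * m + k + 2)"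
  proof -
    have "k + (2 * m + Suc k) + 3 = 2 * (m + k + 2)" "k + (2 * m + Suc k) + 1 = 2 * (m + k + 1)"
      "Suc (2 * m + Suc k) = 2 * m + k + 2" by simp_all
    then show ?thesis unfolding fwd_mean_diagonal[OF assms] fwd_chain_def by (simp only:)
  qed
  also have "\<dots> = fwd_chain q \<Phi> k m + (\<Phi> (2 * (m + k + 2)) / of_nat q ^ (2 * m + k + 2) -
      \<Phi> (2 * (m + k + 1)) / of_nat q ^ (2 * m + k + 2))"
    by (simp only: diff_divide_distrib)
  also have "\<Phi> (2 * (m + k + 2)) / of_nat q ^ (2 * m + k + 2) = of_nat q ^ (k + 2) * damped q \<Phi> (m + k + 2)"
    using assms by (simp add: damped_def field_simps flip: power_add)
  also have "\<Phi> (2 * (m + k + 1)) / of_nat q ^ (2 * m + k + 2) = of_nat q ^ k * damped q \<Phi> (m + k + 1)"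
    using assms by (simp add: damped_def field_simps flip: power_add)
  finally show ?thesis by simp
qed

section \<open>Convergence\<close>

abbreviation rho_term :: "nat \<Rightarrow> (nat \<Rightarrow> complex) \<Rightarrow> nat \<Rightarrow> complex" where
  "rho_term q \<Phi> m \<equiv> of_real (rho_ev q (2 * m)) * \<Phi> (2 * m)"

lemma mean_ev_eq: "mean_ev q \<Phi> = infsum (rho_term q \<Phi>) UNIV"
  by (simp add: mean_ev_def mult.commute)

lemma rho_ev_nonneg: "q > 0 \<Longrightarrow> rho_ev q j \<ge> 0"
  by (simp add: rho_ev_def)

text \<open>The integral over \<open>2\<int>\<^bsub>\<ge>0\<^esub>\<close> is a sum over the indices \<open>j = 2 m\<close>.\<close>

lemma integrable_rho_term_summable:
  assumes "q > 0" "integrable (ev_measure (rho_ev q)) \<Phi>"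
  shows "rho_term q \<Phi> summable_on UNIV"
proof -
  let ?E = "{j::nat. even j}"
  have "integrable (count_space ?E) (\<lambda>j. rho_ev q j *\<^sub>R \<Phi> j)"
    using assms(2) unfolding ev_measure_def point_measure_def
    by (subst (asm) integrable_density) (simp_all add: rho_ev_nonneg assms(1))
  then have "Infinite_Set_Sum.abs_summable_on (\<lambda>j. rho_ev q j *\<^sub>R \<Phi> j) ?E"
    by (simp add: Infinite_Set_Sum.abs_summable_on_def)
  moreover have "bij_betw (\<lambda>m. 2 * m) (UNIV :: nat set) ?E"
    by (rule bij_betwI[where g = "\<lambda>j. j div 2"]) auto
  ultimately have "Infinite_Set_Sum.abs_summable_on (\<lambda>m. rho_ev q (2 * m) *\<^sub>R \<Phi> (2 * m)) UNIV"
    using Infinite_Set_Sum.abs_summable_on_reindex_bij_betw[where f = "\<lambda>j. rho_ev q j *\<^sub>R \<Phi> j"] by blast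
  then show ?thesis
    unfolding abs_summable_equivalent[symmetric] scaleR_conv_of_real by (rule abs_summable_summable)
qed

lemma square_gt_1: "q \<ge> 2 \<Longrightarrow> (real q)\<^sup>2 > 1"
  by (simp add: one_less_power)

lemma rho_term_Suc:
  assumes "q > 0"
  shows "rho_term q \<Phi> (Suc j) = of_real (((real q)\<^sup>2 - 1) / real q) * damped q \<Phi> (Suc j)"
proof -
  have "real q ^ (2 * j + 3) = real q * real q ^ (2 * Suc j)" by (simp add: numeral_3_eq_3)
  then have "rho_ev q (2 * Suc j) = ((real q)\<^sup>2 - 1) / real q / real q ^ (2 * Suc j)"
    unfolding rho_ev_Suc by (simp only: divide_divide_eq_left)
  then show ?thesis by (simp only: damped_def) (simp del: mult_Suc_right)
qed

lemma rho_term_sums: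
  "rho_term q \<Phi> summable_on UNIV \<Longrightarrow> rho_term q \<Phi> sums mean_ev q \<Phi>"
  unfolding mean_ev_eq by (rule has_sum_imp_sums[OF has_sum_infsum])

lemma damped_tendsto_0:
  assumes "q \<ge> 2" "rho_term q \<Phi> summable_on UNIV"
  shows "damped q \<Phi> \<longlonglongrightarrow> 0"
proof -
  have "rho_term q \<Phi> \<longlonglongrightarrow> 0"
    using rho_term_sums[OF assms(2)] sums_summable summable_LIMSEQ_zero by blast
  then have "(\<lambda>j. rho_term q \<Phi> (Suc j) / of_real (((real q)\<^sup>2 - 1) / real q)) \<longlonglongrightarrow> 0"
    by (intro tendsto_divide_zero LIMSEQ_Suc)
  moreover have "rho_term q \<Phi> (Suc j) / of_real (((real q)\<^sup>2 - 1) / real q) = damped q \<Phi> (Suc j)" for j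
  proof -
    have "((real q)\<^sup>2 - 1) / real q > 0"
      using square_gt_1[OF assms(1)] assms(1) by (intro divide_pos_pos) simp_all
    then have "complex_of_real (((real q)\<^sup>2 - 1) / real q) \<noteq> 0"
      unfolding of_real_eq_0_iff by (rule less_imp_neq[THEN not_sym])
    moreover have "q > 0" using assms(1) by simp
    ultimately show ?thesis by (simp only: rho_term_Suc nonzero_mult_div_cancel_left simp_thms)
  qed
  ultimately have "(\<lambda>j. damped q \<Phi> (Suc j)) \<longlonglongrightarrow> 0" by (simp only:)
  then show ?thesis by (rule LIMSEQ_imp_Suc)
qed

lemma bwd_chain_tendsto:
  assumes "q \<ge> 2" "rho_term q \<Phi> summable_on UNIV"
  shows "bwd_chain q \<Phi> \<longlonglongrightarrow> mean_ev q \<Phi>"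
proof -
  have "(\<lambda>m. (\<Sum>i\<le>m. rho_term q \<Phi> i) + damped q \<Phi> m / of_nat q) \<longlonglongrightarrow> mean_ev q \<Phi> + 0 / of_nat q"
    using rho_term_sums[OF assms(2)] damped_tendsto_0[OF assms] assms(1)
    by (intro tendsto_add tendsto_divide) (simp_all add: sums_def_le)
  moreover have "bwd_chain q \<Phi> = (\<lambda>m. (\<Sum>i\<le>m. rho_term q \<Phi> i) + damped q \<Phi> m / of_nat q)"
    using assms(1) by (intro ext bwd_chain_closed_form) simp
  ultimately show ?thesis by simp
qed

lemma fwd_chain_tendsto:
  assumes "q \<ge> 2" "rho_term q \<Phi> summable_on UNIV"
  shows "fwd_chain q \<Phi> k \<longlonglongrightarrow> mean_ev q \<Phi>"
proof (induction k)
  case 0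
  show ?case
    using LIMSEQ_Suc[OF bwd_chain_tendsto[OF assms]] by (simp add: fwd_chain_0[abs_def])
next
  case (Suc k)
  have shift: "(\<lambda>m. damped q \<Phi> (m + n)) \<longlonglongrightarrow> 0" for n
    by (rule LIMSEQ_ignore_initial_segment[OF damped_tendsto_0[OF assms]])
  have "(\<lambda>m. fwd_chain q \<Phi> k m + of_nat q ^ (k + 2) * damped q \<Phi> (m + (k + 2))
      - of_nat q ^ k * damped q \<Phi> (m + (k + 1))) \<longlonglongrightarrow>
      mean_ev q \<Phi> + of_nat q ^ (k + 2) * 0 - of_nat q ^ k * 0"
    by (intro tendsto_intros Suc.IH shift)
  moreover have "fwd_chain q \<Phi> (Suc k) = (\<lambda>m. fwd_chain q \<Phi> k m + of_nat q ^ (k + 2) * damped q \<Phi> (m + (k + 2))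
      - of_nat q ^ k * damped q \<Phi> (m + (k + 1)))"
    using assms(1) by (intro ext) (simp only: fwd_chain_Suc add.assoc)
  ultimately show ?case by simp
qed

lemma tendsto_along_parity:
  fixes f g :: "nat \<Rightarrow> complex"
  assumes "f \<longlonglongrightarrow> L" and g: "\<And>N. K \<le> N \<Longrightarrow> even (K + N) \<Longrightarrow> g N = f ((N - K) div 2)"
  shows "(g \<longlongrightarrow> L) (inf sequentially (principal {N. even (K + N)}))"
proof -
  have "filterlim (\<lambda>N. (N - K) div 2) sequentially sequentially"
    unfolding filterlim_at_top eventually_sequentially
  proof (intro allI)
    fix Z show "\<exists>M. \<forall>N\<ge>M. Z \<le> (N - K) div 2" by (intro exI[of _ "K + 2 * Z"]) auto
  qed
  then have "(\<lambda>N. f ((N - K) div 2)) \<longlonglongrightarrow> L" using assms(1) by (rule filterlim_compose[rotated])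
  then have lim: "((\<lambda>N. f ((N - K) div 2)) \<longlongrightarrow> L) (inf sequentially (principal {N. even (K + N)}))"
    by (rule tendsto_mono[OF inf_le1])
  have "eventually (\<lambda>N. f ((N - K) div 2) = g N) (inf sequentially (principal {N. even (K + N)}))"
    unfolding eventually_inf_principal using eventually_ge_at_top[of K]
    by eventually_elim (simp add: g)
  then show ?thesis using lim by (rule Lim_transform_eventually[rotated])
qed

lemma bwd_mean_chain:
  assumes "k \<le> N" "even (k + N)"
  shows "bwd_mean q \<Phi> k N = bwd_chain q \<Phi> ((N - k) div 2)"
proof -
  have "2 * ((N - k) div 2) = N - k" using assms by auto
  then show ?thesis unfolding bwd_chain_def bwd_mean_shift[OF assms(1)] by simp
qed

lemma fwd_mean_chain:
  assumes "Suc k \<le> N" "even (Suc k + N)"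
  shows "fwd_mean q \<Phi> (Suc k) N = fwd_chain q \<Phi> k ((N - Suc k) div 2)"
proof -
  have "2 * ((N - Suc k) div 2) + Suc k = N" using assms by auto
  then show ?thesis by (simp only: fwd_chain_def)
qed

section \<open>Rates\<close>

text \<open>The increments of the backward means are explicit, so their rate of convergence is obtained from
  a geometric series without estimating the tail of \<open>\<langle>\<Phi>\<rangle>\<close>.\<close>

lemma geometric_increments_bound:
  fixes f :: "nat \<Rightarrow> complex"
  assumes "f \<longlonglongrightarrow> L" and step: "\<And>j. norm (f (Suc j) - f j) \<le> D * s ^ j" and s: "0 \<le> s" "s < 1"
  shows "norm (f m - L) \<le> D * s ^ m / (1 - s)"
proof -
  have "D \<ge> 0" using order_trans[OF norm_ge_zero step[of 0]] by simp
  have "norm (f m - f (m + n)) \<le> D * (s ^ m - s ^ (m + n)) / (1 - s)" for n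
  proof (induction n)
    case (Suc n)
    have "norm (f m - f (m + Suc n)) \<le> norm (f m - f (m + n)) + norm (f (Suc (m + n)) - f (m + n))"
      using norm_triangle_ineq4[of "f m - f (m + n)" "f (Suc (m + n)) - f (m + n)"] by simp
    also have "\<dots> \<le> D * (s ^ m - s ^ (m + n)) / (1 - s) + D * s ^ (m + n)"
      using Suc step by (intro add_mono)
    also have "\<dots> = D * (s ^ m - s ^ (m + Suc n)) / (1 - s)"
      using s by (simp add: field_simps)
    finally show ?case .
  qed simp
  also have "D * (s ^ m - s ^ (m + n)) / (1 - s) \<le> D * s ^ m / (1 - s)" for n
    using \<open>D \<ge> 0\<close> s by (intro divide_right_mono mult_left_mono) simp_all
  finally have "norm (f m - f (m + n)) \<le> D * s ^ m / (1 - s)" for n .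
  moreover have "(\<lambda>n. norm (f m - f (m + n))) \<longlonglongrightarrow> norm (f m - L)"
    using LIMSEQ_ignore_initial_segment[OF assms(1), of m]
    by (intro tendsto_intros) (simp add: add.commute)
  ultimately show ?thesis by (intro LIMSEQ_le_const2) auto
qed

text \<open>The growth \<open>q\<^sup>\<alpha>\<^sup>m\<close> allowed for \<open>\<Phi>(2 m)\<close> against the damping factor \<open>q\<^sup>-\<^sup>2\<^sup>m\<close>.\<close>

lemma powr_ratio:
  assumes "q \<ge> 2"
  shows "real q powr (\<alpha> * real m) / real q ^ (2 * m) = (real q powr (\<alpha> - 2)) ^ m"
proof -
  have "real q ^ (2 * m) = real q powr (2 * real m)"
    using assms powr_realpow[of "real q" "2 * m"] by simp
  moreover have "(real q powr (\<alpha> - 2)) ^ m = real q powr ((\<alpha> - 2) * real m)"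
    using assms powr_realpow[of "real q powr (\<alpha> - 2)" m] by (simp add: powr_powr)
  ultimately show ?thesis by (simp add: powr_diff left_diff_distrib)
qed

lemma damped_bound:
  assumes "q \<ge> 2" "cmod (\<Phi> (2 * m)) \<le> C * real q powr (\<alpha> * real m)"
  shows "cmod (damped q \<Phi> m) \<le> C * (real q powr (\<alpha> - 2)) ^ m"
proof -
  have "cmod (damped q \<Phi> m) = cmod (\<Phi> (2 * m)) / real q ^ (2 * m)"
    by (simp add: damped_def norm_divide norm_power)
  also have "\<dots> \<le> C * real q powr (\<alpha> * real m) / real q ^ (2 * m)"
    using assms by (intro divide_right_mono) simp_all
  finally show ?thesis by (simp only: times_divide_eq_right[symmetric] powr_ratio[OF assms(1)])
qed

lemma decay_ratio:
  assumes "q \<ge> 2" "\<alpha> < 2"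
  shows "0 < real q powr (\<alpha> - 2)" "real q powr (\<alpha> - 2) < 1"
  using assms powr_less_one[of "real q" "\<alpha> - 2"] by simp_all

lemma rho_term_summable_of_growth:
  assumes "q \<ge> 2" "\<alpha> < 2" "\<And>m. cmod (\<Phi> (2 * m)) \<le> C * real q powr (\<alpha> * real m)"
  shows "rho_term q \<Phi> summable_on UNIV"
proof -
  let ?s = "real q powr (\<alpha> - 2)"
  have q2: "(real q)\<^sup>2 > 1" by (rule square_gt_1[OF assms(1)])
  have bound: "norm (rho_term q \<Phi> (Suc j)) \<le> ((real q)\<^sup>2 - 1) / real q * C * ?s ^ Suc j" for j
  proof -
    have "q > 0" "\<bar>((real q)\<^sup>2 - 1) / real q\<bar> = ((real q)\<^sup>2 - 1) / real q" using q2 assms(1) by simp_all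
    then have "norm (rho_term q \<Phi> (Suc j)) = ((real q)\<^sup>2 - 1) / real q * cmod (damped q \<Phi> (Suc j))"
      by (simp only: rho_term_Suc norm_mult norm_of_real)
    also have "\<dots> \<le> ((real q)\<^sup>2 - 1) / real q * (C * ?s ^ Suc j)"
      using q2 assms(1) by (intro mult_left_mono damped_bound assms(3)) simp_all
    finally show ?thesis by simp
  qed
  have "summable (\<lambda>j. ((real q)\<^sup>2 - 1) / real q * C * ?s ^ Suc j)"
    using decay_ratio[OF assms(1,2)] by (intro summable_mult) (simp add: summable_Suc_iff summable_geometric)
  then have "summable (\<lambda>j. norm (rho_term q \<Phi> (Suc j)))"
    by (rule summable_comparison_test') (use bound in simp)
  then have "summable (\<lambda>j. norm (rho_term q \<Phi> j))"
    by (subst (asm) summable_Suc_iff)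
  then show ?thesis by (rule norm_summable_imp_summable_on)
qed

lemma bwd_chain_rate:
  assumes "q \<ge> 2" "\<alpha> < 2" and growth: "\<And>m. cmod (\<Phi> (2 * m)) \<le> C * real q powr (\<alpha> * real m)"
  defines "s \<equiv> real q powr (\<alpha> - 2)"
  shows "cmod (bwd_chain q \<Phi> m - mean_ev q \<Phi>) \<le> (real q + 1) / (1 - s) * C * s ^ m"
proof -
  have s: "0 < s" "s < 1" using decay_ratio[OF assms(1,2)] by (simp_all add: s_def)
  have "C \<ge> 0" using order_trans[OF norm_ge_zero growth[of 0]] assms(1) by simp
  have "norm (bwd_chain q \<Phi> (Suc j) - bwd_chain q \<Phi> j) \<le> (real q + 1) * C * s ^ j" for j
  proof -
    have "bwd_chain q \<Phi> (Suc j) - bwd_chain q \<Phi> j = of_nat q * damped q \<Phi> (Suc j) - damped q \<Phi> j / of_nat q"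
      using assms(1) by (simp add: bwd_chain_Suc_damped)
    then have "norm (bwd_chain q \<Phi> (Suc j) - bwd_chain q \<Phi> j) \<le>
        real q * cmod (damped q \<Phi> (Suc j)) + cmod (damped q \<Phi> j) / real q"
      using norm_triangle_ineq4[of "of_nat q * damped q \<Phi> (Suc j)" "damped q \<Phi> j / of_nat q"]
      by (simp add: norm_mult norm_divide)
    also have "cmod (damped q \<Phi> (Suc j)) \<le> C * s ^ j"
    proof -
      have "s ^ Suc j \<le> s ^ j" using s by (intro power_decreasing) simp_all
      then show ?thesis
        using damped_bound[where \<Phi> = \<Phi> and m = "Suc j", OF assms(1) growth] \<open>C \<ge> 0\<close>
        unfolding s_def by (meson mult_left_mono order_trans)
    qed
    also have "cmod (damped q \<Phi> j) / real q \<le> C * s ^ j"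
    proof -
      have "cmod (damped q \<Phi> j) / real q \<le> cmod (damped q \<Phi> j)"
        using assms(1) by (simp add: divide_le_eq mult_le_cancel_left1)
      then show ?thesis using damped_bound[where \<Phi> = \<Phi> and m = "j", OF assms(1) growth] unfolding s_def by linarith
    qed
    finally show ?thesis using assms(1) by (simp add: algebra_simps)
  qed
  then have "norm (bwd_chain q \<Phi> m - mean_ev q \<Phi>) \<le> (real q + 1) * C * s ^ m / (1 - s)"
    using s bwd_chain_tendsto[OF assms(1) rho_term_summable_of_growth[where \<Phi> = \<Phi> and C = C, OF assms(1,2) growth]]
    by (intro geometric_increments_bound) simp_all
  then show ?thesis by simp
qed

lemma fwd_chain_rate:
  assumes "q \<ge> 2" "\<alpha> < 2"
  defines "s \<equiv> real q powr (\<alpha> - 2)"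
  shows "\<exists>D\<ge>0. \<forall>C \<Phi> m. (\<forall>m. cmod (\<Phi> (2 * m)) \<le> C * real q powr (\<alpha> * real m)) \<longrightarrow>
    cmod (fwd_chain q \<Phi> k m - mean_ev q \<Phi>) \<le> D * C * s ^ m"
proof (induction k)
  case 0
  have s: "0 < s" "s < 1" using decay_ratio[OF assms(1,2)] by (simp_all add: s_def)
  let ?D = "(real q + 1) / (1 - s)"
  show ?case
  proof (intro exI[of _ ?D] conjI allI impI)
    fix C \<Phi> m assume growth: "\<forall>m. cmod (\<Phi> (2 * m)) \<le> C * real q powr (\<alpha> * real m)"
    have "C \<ge> 0" using order_trans[OF norm_ge_zero growth[rule_format, of 0]] assms(1) by simp
    have "cmod (fwd_chain q \<Phi> 0 m - mean_ev q \<Phi>) \<le> ?D * C * s ^ Suc m"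
      unfolding fwd_chain_0 s_def using bwd_chain_rate[where \<Phi> = \<Phi> and C = C, OF assms(1,2) growth[rule_format]] .
    also have "\<dots> \<le> ?D * C * s ^ m"
      using s \<open>C \<ge> 0\<close> by (intro mult_left_mono power_decreasing) simp_all
    finally show "cmod (fwd_chain q \<Phi> 0 m - mean_ev q \<Phi>) \<le> ?D * C * s ^ m" .
  qed (use s in simp)
next
  case (Suc k)
  have s: "0 < s" "s < 1" using decay_ratio[OF assms(1,2)] by (simp_all add: s_def)
  obtain D where D: "D \<ge> 0" "\<And>C \<Phi> m. (\<forall>m. cmod (\<Phi> (2 * m)) \<le> C * real q powr (\<alpha> * real m)) \<Longrightarrow>
    cmod (fwd_chain q \<Phi> k m - mean_ev q \<Phi>) \<le> D * C * s ^ m" using Suc by blast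
  let ?D = "D + real q ^ (k + 2) + real q ^ k"
  show ?case
  proof (intro exI[of _ ?D] conjI allI impI)
    fix C \<Phi> m assume growth: "\<forall>m. cmod (\<Phi> (2 * m)) \<le> C * real q powr (\<alpha> * real m)"
    have "C \<ge> 0" using order_trans[OF norm_ge_zero growth[rule_format, of 0]] assms(1) by simp
    have sc: "cmod (damped q \<Phi> (m + i)) \<le> C * s ^ m" for i
    proof -
      have "cmod (damped q \<Phi> (m + i)) \<le> C * s ^ (m + i)"
        unfolding s_def by (rule damped_bound[where \<Phi> = \<Phi> and m = "m + i", OF assms(1) growth[rule_format]])
      also have "\<dots> \<le> C * s ^ m"
        using s \<open>C \<ge> 0\<close> by (intro mult_left_mono power_decreasing) simp_all
      finally show ?thesis .
    qed
    let ?a = "fwd_chain q \<Phi> k m - mean_ev q \<Phi>" and ?b = "of_nat q ^ (k + 2) * damped q \<Phi> (m + (k + 2))"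
      and ?c = "of_nat q ^ k * damped q \<Phi> (m + (k + 1))"
    have split: "fwd_chain q \<Phi> (Suc k) m - mean_ev q \<Phi> = ?a + ?b - ?c"
      using assms(1) by (simp add: fwd_chain_Suc add.assoc)
    have "cmod (fwd_chain q \<Phi> (Suc k) m - mean_ev q \<Phi>) \<le> cmod ?a + cmod ?b + cmod ?c"
      unfolding split using norm_triangle_ineq4[of "?a + ?b" ?c] norm_triangle_ineq[of ?a ?b] by linarith
    also have "cmod ?a \<le> D * C * s ^ m" using D(2) growth by blast
    also have "cmod ?b \<le> real q ^ (k + 2) * (C * s ^ m)"
      unfolding norm_mult norm_power norm_of_nat by (intro mult_left_mono sc) simp
    also have "cmod ?c \<le> real q ^ k * (C * s ^ m)"
      unfolding norm_mult norm_power norm_of_nat by (intro mult_left_mono sc) simp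
    finally show "cmod (fwd_chain q \<Phi> (Suc k) m - mean_ev q \<Phi>) \<le> ?D * C * s ^ m"
      by (simp add: algebra_simps)
  qed (use D in simp)
qed

lemma decay_power:
  assumes "q \<ge> 2" "K \<le> N" "even (K + N)"
  shows "(real q powr (\<alpha> - 2)) ^ ((N - K) div 2) = real q powr (- (2 - \<alpha>) * (real N - real K) / 2)"
proof -
  have "real ((N - K) div 2) = (real N - real K) / 2" using assms(2,3) by (auto simp: real_of_nat_div)
  moreover have "(real q powr (\<alpha> - 2)) ^ m = real q powr ((\<alpha> - 2) * real m)" for m
    using assms powr_realpow[of "real q powr (\<alpha> - 2)" m] by (simp add: powr_powr)
  ultimately have "(real q powr (\<alpha> - 2)) ^ ((N - K) div 2) = real q powr ((\<alpha> - 2) * ((real N - real K) / 2))"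
    by (simp only:)
  also have "(\<alpha> - 2) * ((real N - real K) / 2) = - (2 - \<alpha>) * (real N - real K) / 2" by simp
  finally show ?thesis .
qed

lemma powi_neg_Suc: "(x :: complex) powi (- int n - 1) = 1 / x ^ Suc n" "x powi (- int n) = 1 / x ^ n"
proof -
  have "- int n - 1 = - int (Suc n)" by simp
  then show "x powi (- int n - 1) = 1 / x ^ Suc n" "x powi (- int n) = 1 / x ^ n"
    by (simp_all only: power_int_minus power_int_of_nat inverse_eq_divide)
qed

text \<open>The probabilities of never turning back and of turning back first after \<open>r\<close> upward steps add up to one.\<close>

lemma geometric_weights:
  assumes "(x :: complex) \<noteq> 0"
  shows "1 / x ^ N + (x - 1) * (\<Sum>r<N. 1 / x ^ Suc r) = 1"
proof (induction N)
  case (Suc N)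
  have "1 / x ^ Suc N + (x - 1) * (1 / x ^ Suc N) = 1 / x ^ N" using assms by (simp add: field_simps)
  moreover have "1 / x ^ Suc N + (x - 1) * (\<Sum>r<Suc N. 1 / x ^ Suc r) =
      (1 / x ^ Suc N + (x - 1) * (1 / x ^ Suc N)) + (x - 1) * (\<Sum>r<N. 1 / x ^ Suc r)"
    by (simp only: sum.lessThan_Suc distrib_left add_ac)
  ultimately show ?case using Suc by (simp only:)
qed simp

theorem theorem1p1:
  fixes \<kappa> :: "'a::{field,finite} itself" and q :: nat
  assumes q: "q = CARD('a)"
  shows
    "(\<forall>k N M. \<forall>\<Phi> :: nat \<Rightarrow> complex.
        even (k + N) \<and> k \<le> N \<and> M = N - k \<and> integrable (ev_measure (rho_ev q)) \<Phi> \<longrightarrow>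
        (\<integral>j. \<Phi> j \<partial>ev_measure (mu_bwd \<kappa> k N)) - mean_ev q \<Phi> =
          of_nat q powi (- int M - 1) * \<Phi> M
          - (\<Sum>\<^sub>\<infinity>m\<in>{m. 2 * m \<ge> M + 2}. of_real (rho_ev q (2 * m)) * \<Phi> (2 * m)))
     \<and>
     (\<forall>k N. \<forall>\<Phi> :: nat \<Rightarrow> complex.
        even (k + N) \<and> 1 \<le> k \<and> integrable (ev_measure (rho_ev q)) \<Phi> \<longrightarrow>
        (\<integral>j. \<Phi> j \<partial>ev_measure (mu_fwd \<kappa> k N)) - mean_ev q \<Phi> =
          of_nat q powi (- int N) * (\<Phi> (k + N) - mean_ev q \<Phi>)
          + (of_nat q - 1) * (\<Sum>r<N. of_nat q powi (- int r - 1) *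
              ((\<integral>j. \<Phi> j \<partial>ev_measure (mu_bwd \<kappa> (k + r - 1) (N - r - 1))) - mean_ev q \<Phi>)))
     \<and>
     (\<forall>\<Phi> :: nat \<Rightarrow> complex. integrable (ev_measure (rho_ev q)) \<Phi> \<longrightarrow>
        (\<forall>k. ((\<lambda>N. \<integral>j. \<Phi> j \<partial>ev_measure (mu_bwd \<kappa> k N)) \<longlongrightarrow> mean_ev q \<Phi>)
               (inf sequentially (principal {N. even (k + N)}))) \<and>
        (\<forall>k\<ge>1. ((\<lambda>N. \<integral>j. \<Phi> j \<partial>ev_measure (mu_fwd \<kappa> k N)) \<longlongrightarrow> mean_ev q \<Phi>)
               (inf sequentially (principal {N. even (k + N)}))))
     \<and>
     (\<forall>\<alpha>::real. \<alpha> < 2 \<longrightarrow>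
        (\<exists>C'::real. \<forall>C>0. \<forall>\<Phi> :: nat \<Rightarrow> complex.
           (\<forall>m. cmod (\<Phi> (2 * m)) \<le> C * real q powr (\<alpha> * real m)) \<longrightarrow>
           (\<forall>k N. k \<le> N \<and> even (k + N) \<longrightarrow>
              cmod ((\<integral>j. \<Phi> j \<partial>ev_measure (mu_bwd \<kappa> k N)) - mean_ev q \<Phi>)
                \<le> C' * (C * real q powr (- (2 - \<alpha>) * (real N - real k) / 2)))) \<and>
        (\<forall>k\<ge>1. \<exists>C'::real. \<forall>C>0. \<forall>\<Phi> :: nat \<Rightarrow> complex.
           (\<forall>m. cmod (\<Phi> (2 * m)) \<le> C * real q powr (\<alpha> * real m)) \<longrightarrow>
           (\<forall>N. k \<le> N \<and> even (k + N) \<longrightarrow>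
              cmod ((\<integral>j. \<Phi> j \<partial>ev_measure (mu_fwd \<kappa> k N)) - mean_ev q \<Phi>)
                \<le> C' * (if \<alpha> < 1 then C * real q powr (- real N / 2)
                        else if \<alpha> = 1 then C * real N * real q powr (- real N / 2)
                        else C * real q powr (- ((2 - \<alpha>) / 2) * real N)))))"
    (is "?a \<and> ?b \<and> ?c \<and> ?d")
proof -
  have "card {0, 1 :: 'a} \<le> CARD('a)" by (rule card_mono) simp_all
  then have q2: "q \<ge> 2" by (simp add: q)
  then have q0: "(of_nat q :: complex) \<noteq> 0" by simp
  (* Only the even arguments of a profile matter, so it may be taken to vanish at the odd ones. *)
  define ev :: "(nat \<Rightarrow> complex) \<Rightarrow> nat \<Rightarrow> complex" where "ev = (\<lambda>\<Phi> j. if even j then \<Phi> j else 0)"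
  have ev: "ev \<Phi> (2 * m) = \<Phi> (2 * m)" for \<Phi> m by (simp add: ev_def)
  have mean: "mean_ev q (ev \<Phi>) = mean_ev q \<Phi>" for \<Phi> by (simp only: mean_ev_def ev)
  have bwd: "(\<integral>j. \<Phi> j \<partial>ev_measure (mu_bwd \<kappa> k N)) = bwd_mean q (ev \<Phi>) k N" for \<Phi> k N
    unfolding q ev_def by (rule integral_mu_bwd)
  have fwd: "(\<integral>j. \<Phi> j \<partial>ev_measure (mu_fwd \<kappa> (Suc k) N)) = fwd_mean q (ev \<Phi>) (Suc k) N" for \<Phi> k N
    unfolding q ev_def by (rule integral_mu_fwd)
  have summable: "rho_term q (ev \<Phi>) summable_on UNIV" if "integrable (ev_measure (rho_ev q)) \<Phi>" for \<Phi>
    unfolding ev using that q2 by (intro integrable_rho_term_summable) simp_all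
  have a: ?a
  proof (intro allI impI, elim conjE)
    fix k N M :: nat and \<Phi> :: "nat \<Rightarrow> complex"
    assume A: "even (k + N)" "k \<le> N" "M = N - k" "integrable (ev_measure (rho_ev q)) \<Phi>"
    define m where "m = (N - k) div 2"
    have M: "M = 2 * m" using A by (auto simp: m_def)
    let ?t = "rho_term q (ev \<Phi>)"
    have "mean_ev q (ev \<Phi>) = infsum ?t ({..m} \<union> {m<..})"
      unfolding mean_ev_eq by (rule arg_cong[where f = "infsum ?t"]) auto
    also have "\<dots> = infsum ?t {..m} + infsum ?t {m<..}"
      by (rule infsum_Un_disjoint) (auto intro: summable_on_subset_banach[OF summable[OF A(4)]])
    finally have total: "mean_ev q (ev \<Phi>) = (\<Sum>i\<le>m. ?t i) + infsum ?t {m<..}" by simp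
    have "{m<..} = {i. 2 * i \<ge> M + 2}" by (auto simp: M)
    then have tail: "infsum ?t {m<..} =
        (\<Sum>\<^sub>\<infinity>m\<in>{m. 2 * m \<ge> M + 2}. of_real (rho_ev q (2 * m)) * \<Phi> (2 * m))"
      by (simp only: ev)
    have "bwd_mean q (ev \<Phi>) k N = (\<Sum>i\<le>m. ?t i) + damped q (ev \<Phi>) m / of_nat q"
      unfolding bwd_mean_chain[OF A(2,1)] m_def using q2 by (intro bwd_chain_closed_form) simp
    also have "damped q (ev \<Phi>) m / of_nat q = of_nat q powi (- int M - 1) * \<Phi> M"
      unfolding powi_neg_Suc damped_def ev M by simp
    finally show "(\<integral>j. \<Phi> j \<partial>ev_measure (mu_bwd \<kappa> k N)) - mean_ev q \<Phi> =
        of_nat q powi (- int M - 1) * \<Phi> M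
        - (\<Sum>\<^sub>\<infinity>m\<in>{m. 2 * m \<ge> M + 2}. of_real (rho_ev q (2 * m)) * \<Phi> (2 * m))"
      unfolding bwd mean[of \<Phi>, symmetric] total tail by simp
  qed
  have b: ?b
  proof (intro allI impI, elim conjE)
    fix k N :: nat and \<Phi> :: "nat \<Rightarrow> complex"
    assume A: "even (k + N)" "1 \<le> k" "integrable (ev_measure (rho_ev q)) \<Phi>"
    obtain l where k: "k = Suc l" using A(2) by (cases k) auto
    let ?Q = "of_nat q :: complex" and ?\<mu> = "mean_ev q \<Phi>"
    let ?B = "\<lambda>r. bwd_mean q (ev \<Phi>) (l + r) (N - r - 1)"
    have split: "(\<Sum>r<N. (?B r - ?\<mu>) / ?Q ^ Suc r) =
        (\<Sum>r<N. ?B r / ?Q ^ Suc r) - ?\<mu> * (\<Sum>r<N. 1 / ?Q ^ Suc r)"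
      by (simp add: diff_divide_distrib sum_subtractf sum_distrib_left)
    have one: "?\<mu> = ?\<mu> / ?Q ^ N + (?Q - 1) * (?\<mu> * (\<Sum>r<N. 1 / ?Q ^ Suc r))"
      using arg_cong[OF geometric_weights[OF q0, of N], of "\<lambda>x. ?\<mu> * x"]
      by (simp only: distrib_left mult_1_right times_divide_eq_right mult.left_commute[of ?\<mu>])
    have "fwd_mean q (ev \<Phi>) (Suc l) N - ?\<mu> = (ev \<Phi> (Suc l + N) - ?\<mu>) / ?Q ^ N +
        (?Q - 1) * (\<Sum>r<N. (?B r - ?\<mu>) / ?Q ^ Suc r)"
      unfolding split fwd_mean_unroll by (subst (1) one) (simp only: diff_divide_distrib right_diff_distrib, simp)
    moreover have "ev \<Phi> (Suc l + N) = \<Phi> (Suc l + N)" using A(1) k by (simp add: ev_def)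
    ultimately show "(\<integral>j. \<Phi> j \<partial>ev_measure (mu_fwd \<kappa> k N)) - ?\<mu> =
          of_nat q powi (- int N) * (\<Phi> (k + N) - ?\<mu>)
          + (of_nat q - 1) * (\<Sum>r<N. of_nat q powi (- int r - 1) *
              ((\<integral>j. \<Phi> j \<partial>ev_measure (mu_bwd \<kappa> (k + r - 1) (N - r - 1))) - ?\<mu>))"
      unfolding k fwd bwd powi_neg_Suc by simp
  qed
  have c: ?c
  proof (intro allI impI conjI)
    fix \<Phi> :: "nat \<Rightarrow> complex" and k :: nat assume A: "integrable (ev_measure (rho_ev q)) \<Phi>"
    show "((\<lambda>N. \<integral>j. \<Phi> j \<partial>ev_measure (mu_bwd \<kappa> k N)) \<longlongrightarrow> mean_ev q \<Phi>)
        (inf sequentially (principal {N. even (k + N)}))"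
      unfolding bwd mean[of \<Phi>, symmetric]
      by (rule tendsto_along_parity[OF bwd_chain_tendsto[OF q2 summable[OF A]] bwd_mean_chain])
    assume "1 \<le> k"
    then obtain l where k: "k = Suc l" by (cases k) auto
    show "((\<lambda>N. \<integral>j. \<Phi> j \<partial>ev_measure (mu_fwd \<kappa> k N)) \<longlongrightarrow> mean_ev q \<Phi>)
        (inf sequentially (principal {N. even (k + N)}))"
      unfolding k fwd mean[of \<Phi>, symmetric]
      by (rule tendsto_along_parity[OF fwd_chain_tendsto[OF q2 summable[OF A]] fwd_mean_chain])
  qed
  have d: ?d
  proof (intro allI impI)
    fix \<alpha> :: real assume \<alpha>: "\<alpha> < 2"
    let ?s = "real q powr (\<alpha> - 2)"
    show "(\<exists>C'::real. \<forall>C>0. \<forall>\<Phi> :: nat \<Rightarrow> complex.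
           (\<forall>m. cmod (\<Phi> (2 * m)) \<le> C * real q powr (\<alpha> * real m)) \<longrightarrow>
           (\<forall>k N. k \<le> N \<and> even (k + N) \<longrightarrow>
              cmod ((\<integral>j. \<Phi> j \<partial>ev_measure (mu_bwd \<kappa> k N)) - mean_ev q \<Phi>)
                \<le> C' * (C * real q powr (- (2 - \<alpha>) * (real N - real k) / 2)))) \<and>
        (\<forall>k\<ge>1. \<exists>C'::real. \<forall>C>0. \<forall>\<Phi> :: nat \<Rightarrow> complex.
           (\<forall>m. cmod (\<Phi> (2 * m)) \<le> C * real q powr (\<alpha> * real m)) \<longrightarrow>
           (\<forall>N. k \<le> N \<and> even (k + N) \<longrightarrow>
              cmod ((\<integral>j. \<Phi> j \<partial>ev_measure (mu_fwd \<kappa> k N)) - mean_ev q \<Phi>)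
                \<le> C' * (if \<alpha> < 1 then C * real q powr (- real N / 2)
                        else if \<alpha> = 1 then C * real N * real q powr (- real N / 2)
                        else C * real q powr (- ((2 - \<alpha>) / 2) * real N))))"
    proof (intro conjI allI impI)
      show "\<exists>C'::real. \<forall>C>0. \<forall>\<Phi> :: nat \<Rightarrow> complex.
           (\<forall>m. cmod (\<Phi> (2 * m)) \<le> C * real q powr (\<alpha> * real m)) \<longrightarrow>
           (\<forall>k N. k \<le> N \<and> even (k + N) \<longrightarrow>
              cmod ((\<integral>j. \<Phi> j \<partial>ev_measure (mu_bwd \<kappa> k N)) - mean_ev q \<Phi>)
                \<le> C' * (C * real q powr (- (2 - \<alpha>) * (real N - real k) / 2)))"
      proof (intro exI[of _ "(real q + 1) / (1 - ?s)"] allI impI, elim conjE)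
        fix C :: real and \<Phi> :: "nat \<Rightarrow> complex" and k N :: nat
        assume growth: "\<forall>m. cmod (\<Phi> (2 * m)) \<le> C * real q powr (\<alpha> * real m)"
          and kN: "k \<le> N" "even (k + N)"
        have "cmod (bwd_chain q (ev \<Phi>) ((N - k) div 2) - mean_ev q (ev \<Phi>))
            \<le> (real q + 1) / (1 - ?s) * C * ?s ^ ((N - k) div 2)"
          using growth by (intro bwd_chain_rate[OF q2 \<alpha>]) (simp only: ev)
        then show "cmod ((\<integral>j. \<Phi> j \<partial>ev_measure (mu_bwd \<kappa> k N)) - mean_ev q \<Phi>)
                \<le> (real q + 1) / (1 - ?s) * (C * real q powr (- (2 - \<alpha>) * (real N - real k) / 2))"
          unfolding bwd mean bwd_mean_chain[OF kN] decay_power[OF q2 kN] by (simp only: mult.assoc)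
      qed
      fix k :: nat assume "1 \<le> k"
      then obtain l where k: "k = Suc l" by (cases k) auto
      obtain D where D: "D \<ge> 0" "\<And>C \<Phi> m. (\<forall>m. cmod (\<Phi> (2 * m)) \<le> C * real q powr (\<alpha> * real m)) \<Longrightarrow>
          cmod (fwd_chain q \<Phi> l m - mean_ev q \<Phi>) \<le> D * C * ?s ^ m"
        using fwd_chain_rate[OF q2 \<alpha>, of l] by blast
      define \<beta> where "\<beta> = (2 - \<alpha>) / 2"
      have \<beta>: "\<beta> > 0" using \<alpha> by (simp add: \<beta>_def)
      let ?R = "\<lambda>C N. if \<alpha> < 1 then C * real q powr (- real N / 2)
                        else if \<alpha> = 1 then C * real N * real q powr (- real N / 2)
                        else C * real q powr (- ((2 - \<alpha>) / 2) * real N)"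
      show "\<exists>C'::real. \<forall>C>0. \<forall>\<Phi> :: nat \<Rightarrow> complex.
           (\<forall>m. cmod (\<Phi> (2 * m)) \<le> C * real q powr (\<alpha> * real m)) \<longrightarrow>
           (\<forall>N. k \<le> N \<and> even (k + N) \<longrightarrow>
              cmod ((\<integral>j. \<Phi> j \<partial>ev_measure (mu_fwd \<kappa> k N)) - mean_ev q \<Phi>) \<le> C' * ?R C N)"
      proof (intro exI[of _ "D * real q powr (\<beta> * real k)"] allI impI, elim conjE)
        fix C :: real and \<Phi> :: "nat \<Rightarrow> complex" and N :: nat
        assume C: "C > 0" and growth: "\<forall>m. cmod (\<Phi> (2 * m)) \<le> C * real q powr (\<alpha> * real m)"
          and kN: "k \<le> N" "even (k + N)"
        have "cmod (fwd_chain q (ev \<Phi>) l ((N - k) div 2) - mean_ev q (ev \<Phi>)) \<le> D * C * ?s ^ ((N - k) div 2)"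
          using growth by (intro D(2)) (simp add: ev)
        (* the factor q^(beta k) is absorbed in the constant, which may depend on k *)
        also have "?s ^ ((N - k) div 2) = real q powr (\<beta> * real k) * real q powr (- \<beta> * real N)"
        proof -
          have "- (2 - \<alpha>) * (real N - real k) / 2 = \<beta> * real k + - \<beta> * real N"
            unfolding \<beta>_def by (simp add: field_simps)
          then show ?thesis unfolding decay_power[OF q2 kN] powr_add[symmetric] by (simp only:)
        qed
        also have "D * C * (real q powr (\<beta> * real k) * real q powr (- \<beta> * real N)) =
            D * real q powr (\<beta> * real k) * (C * real q powr (- \<beta> * real N))" by simp
        also have "\<dots> \<le> D * real q powr (\<beta> * real k) * ?R C N"
        proof (rule mult_left_mono)
          have N: "real N \<ge> 1" using kN(1) k by simp
          (* alpha <= 1 means beta >= 1/2 *)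
          have half: "real q powr (- \<beta> * real N) \<le> real q powr (- real N / 2)" if "\<alpha> \<le> 1"
          proof -
            have "1 / 2 * real N \<le> \<beta> * real N" using that by (intro mult_right_mono) (simp_all add: \<beta>_def)
            then show ?thesis using q2 by (intro powr_mono) simp_all
          qed
          consider "\<alpha> < 1" | "\<alpha> = 1" | "\<alpha> > 1" by linarith
          then show "C * real q powr (- \<beta> * real N) \<le> ?R C N"
          proof cases
            case 1
            then show ?thesis using half C by simp
          next
            case 2
            have "C * real q powr (- \<beta> * real N) \<le> C * real q powr (- real N / 2)" using half 2 C by simp
            also have "\<dots> \<le> real N * (C * real q powr (- real N / 2))"
              using mult_right_mono[OF N, of "C * real q powr (- real N / 2)"] C by simp
            finally show ?thesis using 2 by (simp add: ac_simps)
          next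
            case 3
            then show ?thesis by (simp add: \<beta>_def)
          qed
        qed (use D in simp)
        finally show "cmod ((\<integral>j. \<Phi> j \<partial>ev_measure (mu_fwd \<kappa> k N)) - mean_ev q \<Phi>)
            \<le> D * real q powr (\<beta> * real k) * ?R C N"
          using kN unfolding k fwd mean by (simp only: fwd_mean_chain)
      qed
    qed
  qed
  show ?thesis using a b c d by blast
qed

end
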